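(* For smooth stationary planar viscous shock profiles $\overline V(x_1)$, $\overline V(x_1)\to V_\pm$ as $x_1\to\pm\infty$, of the viscous MHD $\beta$-model or of the viscous hybrid MHD model in two space dimensions, weak Evans-Lopatinsky stability holds with the divergence-free constraint if and only if it holds without the constraint, and strong Evans-Lopatinsky stability holds with the divergence-free constraint if and only if it holds without the constraint.
   Context: Let $x=(x_1,x_2)$, $u=(u_1,u_2)$, $h=(h_1,h_2)$, $\mu,\eta,\nu>0$, $\beta\in\mathbb R$ fixed, $p=p(\rho)$, $e_1=(1,0)^T$, $V=(\rho,\rho u_1,\rho u_2,h_1,h_2)$. The viscous $\beta$-model is $$\rho_t+\mathrm{div}(\rho u)=0,$$ $$(\rho u)_t+\mathrm{div}(\rho u\otimes u-h\otimes h)+\nabla\bigl(p+\tfrac{|h|^2}{2}\bigr)=\mu\Delta u+(\eta+\mu)\nabla\mathrm{div}\,u,$$ $$h_t-\nabla\times(u\times h)+\beta\,\mathrm{div}(h)e_1=\nu\Delta h,$$ with $-\nabla\times(u\times h)=\bigl(\partial_{x_2}(u_2h_1-u_1h_2),\,\partial_{x_1}(u_1h_2-u_2h_1)\bigr)^T$. The viscous hybrid model is the $\beta=0$ system with the terms $h\,\mathrm{div}\,h$ and $u\,\mathrm{div}\,h$ added to the left sides of the second and third equations, respectively. The constraint is $\mathrm{div}\,h=0$; profiles satisfy it (i.e. $\bar h_1$ is constant). Linearize the model about $\overline V(x_1)$, and for $\lambda\in\mathbb C$, $\xi\in\mathbb R$ substitute $V(x,t)=e^{\lambda t+i\xi x_2}\hat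 V(x_1)$ to obtain an ODE eigenvalue equation on $\mathbb R$ for $\hat V$. A decaying normal mode at $(\xi,\lambda)$ is a nontrivial solution $\hat V$ of this ODE decaying to $0$ as $x_1\to\pm\infty$ (equivalently, a zero of the Evans function). The endstates satisfy the weak dissipativity condition $\mathrm{Re}\,\sigma(\mathcal S_\pm(k))\le-\theta|k|^2/(1+|k|^2)$ for all $k\in\mathbb R^2$ and some $\theta>0$, where $\mathcal S_\pm(k)$ is the Fourier symbol of the linearized operator at the constant state $V_\pm$. Weak Evans-Lopatinsky stability without constraint: no decaying normal mode exists for $\xi\in\mathbb R$, $\mathrm{Re}\,\lambda>0$. Strong Evans-Lopatinsky stability without constraint: no decaying normal mode exists for $\xi\in\mathbb R$, $\mathrm{Re}\,\lambda\ge0$, $(\xi,\lambda)\ne(0,0)$. The corresponding notions with constraint: no decaying normal mode exists in the same range of $(\xi,\lambda)$ which satisfies in addition the transformed constraint $\partial_{x_1}\hat V_4+i\xi\hat V_5=0$. *)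

theory Defs
  imports "HOL-Analysis.Analysis"
begin

datatype mhd_model = Beta_Model real | Hybrid_Model

section \<open>Planar differential operators\<close>

definition d1 :: "(real \<Rightarrow> real \<Rightarrow> real) \<Rightarrow> real \<Rightarrow> real \<Rightarrow> real" where
  "d1 f x1 x2 = deriv (\<lambda>y. f y x2) x1"

definition d2 :: "(real \<Rightarrow> real \<Rightarrow> real) \<Rightarrow> real \<Rightarrow> real \<Rightarrow> real" where
  "d2 f x1 x2 = deriv (\<lambda>y. f x1 y) x2"

definition laplacian :: "(real \<Rightarrow> real \<Rightarrow> real) \<Rightarrow> real \<Rightarrow> real \<Rightarrow> real" where
  "laplacian f x1 x2 = d1 (d1 f) x1 x2 + d2 (d2 f) x1 x2"

definition divergence ::
  "(real \<Rightarrow> real \<Rightarrow> real) \<Rightarrow> (real \<Rightarrow> real \<Rightarrow> real) \<Rightarrow> real \<Rightarrow> real \<Rightarrow> real" where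
  "divergence f1 f2 x1 x2 = d1 f1 x1 x2 + d2 f2 x1 x2"

section \<open>The viscous \<open>\<beta>\<close>-model and the viscous hybrid model\<close>

text \<open>
  A state field is \<open>V = (\<rho>, \<rho> u\<^sub>1, \<rho> u\<^sub>2, h\<^sub>1, h\<^sub>2)\<close>.  Either model has the form
  \<open>V\<^sub>t = mhd_op V\<close>.
\<close>

definition mhd_op ::
  "mhd_model \<Rightarrow> real \<Rightarrow> real \<Rightarrow> real \<Rightarrow> (real \<Rightarrow> real) \<Rightarrow>
    (real \<Rightarrow> real \<Rightarrow> real ^ 5) \<Rightarrow> real \<Rightarrow> real \<Rightarrow> real ^ 5" where
  "mhd_op M \<mu> \<eta> \<nu> p V x1 x2 =
    (let \<rho>  = (\<lambda>y1 y2. V y1 y2 $ 1);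
         m1 = (\<lambda>y1 y2. V y1 y2 $ 2);
         m2 = (\<lambda>y1 y2. V y1 y2 $ 3);
         h1 = (\<lambda>y1 y2. V y1 y2 $ 4);
         h2 = (\<lambda>y1 y2. V y1 y2 $ 5);
         u1 = (\<lambda>y1 y2. m1 y1 y2 / \<rho> y1 y2);
         u2 = (\<lambda>y1 y2. m2 y1 y2 / \<rho> y1 y2);
         q  = (\<lambda>y1 y2. p (\<rho> y1 y2) + ((h1 y1 y2)\<^sup>2 + (h2 y1 y2)\<^sup>2) / 2);
         divh = divergence h1 h2;
         \<beta> = (case M of Beta_Model b \<Rightarrow> b | Hybrid_Model \<Rightarrow> 0);
         \<kappa> = (case M of Beta_Model b \<Rightarrow> 0 | Hybrid_Model \<Rightarrow> 1)
     in vector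
       [ - divergence m1 m2 x1 x2,
         - divergence (\<lambda>y1 y2. \<rho> y1 y2 * u1 y1 y2 * u1 y1 y2 - h1 y1 y2 * h1 y1 y2)
                      (\<lambda>y1 y2. \<rho> y1 y2 * u1 y1 y2 * u2 y1 y2 - h1 y1 y2 * h2 y1 y2) x1 x2
           - d1 q x1 x2 - \<kappa> * (h1 x1 x2 * divh x1 x2)
           + \<mu> * laplacian u1 x1 x2 + (\<eta> + \<mu>) * d1 (divergence u1 u2) x1 x2,
         - divergence (\<lambda>y1 y2. \<rho> y1 y2 * u2 y1 y2 * u1 y1 y2 - h2 y1 y2 * h1 y1 y2)
                      (\<lambda>y1 y2. \<rho> y1 y2 * u2 y1 y2 * u2 y1 y2 - h2 y1 y2 * h2 y1 y2) x1 x2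
           - d2 q x1 x2 - \<kappa> * (h2 x1 x2 * divh x1 x2)
           + \<mu> * laplacian u2 x1 x2 + (\<eta> + \<mu>) * d2 (divergence u1 u2) x1 x2,
         - d2 (\<lambda>y1 y2. u2 y1 y2 * h1 y1 y2 - u1 y1 y2 * h2 y1 y2) x1 x2
           - \<beta> * divh x1 x2 - \<kappa> * (u1 x1 x2 * divh x1 x2)
           + \<nu> * laplacian h1 x1 x2,
         - d1 (\<lambda>y1 y2. u1 y1 y2 * h2 y1 y2 - u2 y1 y2 * h1 y1 y2) x1 x2
           - \<kappa> * (u2 x1 x2 * divh x1 x2)
           + \<nu> * laplacian h2 x1 x2 ])"

section \<open>Linearization\<close>

text \<open>
  The linearization about \<open>Vbar\<close> is the pointwise Gateaux derivative of \<open>mhd_op\<close>; it is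
  extended complex-linearly to complex perturbations through their real and imaginary parts.
\<close>

definition lin_op_real ::
  "mhd_model \<Rightarrow> real \<Rightarrow> real \<Rightarrow> real \<Rightarrow> (real \<Rightarrow> real) \<Rightarrow> (real \<Rightarrow> real \<Rightarrow> real ^ 5) \<Rightarrow>
    (real \<Rightarrow> real \<Rightarrow> real ^ 5) \<Rightarrow> real \<Rightarrow> real \<Rightarrow> real ^ 5" where
  "lin_op_real M \<mu> \<eta> \<nu> p Vbar W x1 x2 =
    vector_derivative
      (\<lambda>\<epsilon>. mhd_op M \<mu> \<eta> \<nu> p (\<lambda>y1 y2. Vbar y1 y2 + \<epsilon> *\<^sub>R W y1 y2) x1 x2) (at 0)"

definition lin_op ::
  "mhd_model \<Rightarrow> real \<Rightarrow> real \<Rightarrow> real \<Rightarrow> (real \<Rightarrow> real) \<Rightarrow> (real \<Rightarrow> real \<Rightarrow> real ^ 5) \<Rightarrow>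
    (real \<Rightarrow> real \<Rightarrow> complex ^ 5) \<Rightarrow> real \<Rightarrow> real \<Rightarrow> complex ^ 5" where
  "lin_op M \<mu> \<eta> \<nu> p Vbar W x1 x2 =
    (\<chi> j. Complex
      (lin_op_real M \<mu> \<eta> \<nu> p Vbar (\<lambda>y1 y2. \<chi> l. Re (W y1 y2 $ l)) x1 x2 $ j)
      (lin_op_real M \<mu> \<eta> \<nu> p Vbar (\<lambda>y1 y2. \<chi> l. Im (W y1 y2 $ l)) x1 x2 $ j))"

definition linearized_solution ::
  "mhd_model \<Rightarrow> real \<Rightarrow> real \<Rightarrow> real \<Rightarrow> (real \<Rightarrow> real) \<Rightarrow> (real \<Rightarrow> real \<Rightarrow> real ^ 5) \<Rightarrow>
    (real \<Rightarrow> real \<Rightarrow> real \<Rightarrow> complex ^ 5) \<Rightarrow> bool" where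
  "linearized_solution M \<mu> \<eta> \<nu> p Vbar V \<longleftrightarrow>
    (\<forall>t x1 x2. ((\<lambda>s. V s x1 x2) has_vector_derivative
                  lin_op M \<mu> \<eta> \<nu> p Vbar (V t) x1 x2) (at t))"

section \<open>Weak dissipativity of the endstates\<close>

text \<open>
  At a constant state the linearized operator has constant coefficients and maps
  \<open>e\<^bsup>ik\<cdot>x\<^esup> v\<close> to \<open>e\<^bsup>ik\<cdot>x\<^esup> S(k) v\<close>; the symbol \<open>S(k)\<close> is read off at \<open>x = 0\<close>.
\<close>

definition fourier_symbol ::
  "mhd_model \<Rightarrow> real \<Rightarrow> real \<Rightarrow> real \<Rightarrow> (real \<Rightarrow> real) \<Rightarrow> real ^ 5 \<Rightarrow> real ^ 2 \<Rightarrow>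
    complex ^ 5 ^ 5" where
  "fourier_symbol M \<mu> \<eta> \<nu> p Vc k =
    matrix (\<lambda>v. lin_op M \<mu> \<eta> \<nu> p (\<lambda>y1 y2. Vc)
      (\<lambda>y1 y2. exp (\<i> * complex_of_real (k $ 1 * y1 + k $ 2 * y2)) *s v) 0 0)"

definition eigenvalues :: "complex ^ 'n ^ 'n \<Rightarrow> complex set" where
  "eigenvalues A = {s. \<exists>v. v \<noteq> 0 \<and> A *v v = s *s v}"

definition weakly_dissipative ::
  "mhd_model \<Rightarrow> real \<Rightarrow> real \<Rightarrow> real \<Rightarrow> (real \<Rightarrow> real) \<Rightarrow> real ^ 5 \<Rightarrow> bool" where
  "weakly_dissipative M \<mu> \<eta> \<nu> p Vc \<longleftrightarrow>
    (\<exists>\<theta>>0. \<forall>k. \<forall>s \<in> eigenvalues (fourier_symbol M \<mu> \<eta> \<nu> p Vc k).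
       Re s \<le> - \<theta> * (norm k)\<^sup>2 / (1 + (norm k)\<^sup>2))"

section \<open>Viscous shock profiles\<close>

definition smooth_fun_on :: "real set \<Rightarrow> (real \<Rightarrow> real) \<Rightarrow> bool" where
  "smooth_fun_on S f \<longleftrightarrow> (\<forall>n. ((deriv ^^ n) f) differentiable_on S)"

definition viscous_shock_profile ::
  "mhd_model \<Rightarrow> real \<Rightarrow> real \<Rightarrow> real \<Rightarrow> (real \<Rightarrow> real) \<Rightarrow> (real \<Rightarrow> real ^ 5) \<Rightarrow>
    real ^ 5 \<Rightarrow> real ^ 5 \<Rightarrow> bool" where
  "viscous_shock_profile M \<mu> \<eta> \<nu> p Vbar Vminus Vplus \<longleftrightarrow>
    (\<forall>j. smooth_fun_on UNIV (\<lambda>x. Vbar x $ j)) \<and>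
    (\<forall>x. Vbar x $ 1 > 0) \<and> Vminus $ 1 > 0 \<and> Vplus $ 1 > 0 \<and>
    Vminus \<noteq> Vplus \<and>
    (Vbar \<longlongrightarrow> Vminus) at_bot \<and> (Vbar \<longlongrightarrow> Vplus) at_top \<and>
    (\<forall>x1 x2. mhd_op M \<mu> \<eta> \<nu> p (\<lambda>y1 y2. Vbar y1) x1 x2 = 0) \<and>
    (\<forall>x1 x2. divergence (\<lambda>y1 y2. Vbar y1 $ 4) (\<lambda>y1 y2. Vbar y1 $ 5) x1 x2 = 0)"

section \<open>Decaying normal modes and Evans-Lopatinsky stability\<close>

definition twice_cont_diff :: "(real \<Rightarrow> 'a::real_normed_vector) \<Rightarrow> bool" where
  "twice_cont_diff f \<longleftrightarrow>
    (\<exists>f' f''. (\<forall>x. (f has_vector_derivative f' x) (at x)) \<and>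
              (\<forall>x. (f' has_vector_derivative f'' x) (at x)) \<and>
              continuous_on UNIV f'')"

text \<open>
  Modes are classical solutions.  Second derivatives of \<open>m\<^sub>j / \<rho>\<close> are taken in the state
  variables, so all components are required to be twice continuously differentiable; away from
  zero mass flux the first-order \<open>\<rho>\<close>-equation gives this regularity automatically.
\<close>

definition decaying_normal_mode ::
  "mhd_model \<Rightarrow> real \<Rightarrow> real \<Rightarrow> real \<Rightarrow> (real \<Rightarrow> real) \<Rightarrow> (real \<Rightarrow> real ^ 5) \<Rightarrow>
    real \<Rightarrow> complex \<Rightarrow> (real \<Rightarrow> complex ^ 5) \<Rightarrow> bool" where
  "decaying_normal_mode M \<mu> \<eta> \<nu> p Vbar \<xi> lam Vhat \<longleftrightarrow>
    twice_cont_diff Vhat \<and> (\<exists>x. Vhat x \<noteq> 0) \<and>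
    (Vhat \<longlongrightarrow> 0) at_bot \<and> (Vhat \<longlongrightarrow> 0) at_top \<and>
    linearized_solution M \<mu> \<eta> \<nu> p (\<lambda>y1 y2. Vbar y1)
      (\<lambda>t x1 x2. exp (lam * complex_of_real t + \<i> * complex_of_real (\<xi> * x2)) *s Vhat x1)"

definition transformed_constraint :: "real \<Rightarrow> (real \<Rightarrow> complex ^ 5) \<Rightarrow> bool" where
  "transformed_constraint \<xi> Vhat \<longleftrightarrow>
    (\<forall>x. vector_derivative (\<lambda>y. Vhat y $ 4) (at x) + \<i> * complex_of_real \<xi> * Vhat x $ 5 = 0)"

definition weak_EL_stable ::
  "mhd_model \<Rightarrow> real \<Rightarrow> real \<Rightarrow> real \<Rightarrow> (real \<Rightarrow> real) \<Rightarrow> (real \<Rightarrow> real ^ 5) \<Rightarrow> bool" where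
  "weak_EL_stable M \<mu> \<eta> \<nu> p Vbar \<longleftrightarrow>
    (\<forall>\<xi> lam. Re lam > 0 \<longrightarrow> \<not> (\<exists>Vhat. decaying_normal_mode M \<mu> \<eta> \<nu> p Vbar \<xi> lam Vhat))"

definition strong_EL_stable ::
  "mhd_model \<Rightarrow> real \<Rightarrow> real \<Rightarrow> real \<Rightarrow> (real \<Rightarrow> real) \<Rightarrow> (real \<Rightarrow> real ^ 5) \<Rightarrow> bool" where
  "strong_EL_stable M \<mu> \<eta> \<nu> p Vbar \<longleftrightarrow>
    (\<forall>\<xi> lam. Re lam \<ge> 0 \<and> (\<xi>, lam) \<noteq> (0, 0) \<longrightarrow>
      \<not> (\<exists>Vhat. decaying_normal_mode M \<mu> \<eta> \<nu> p Vbar \<xi> lam Vhat))"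

definition weak_EL_stable_constrained ::
  "mhd_model \<Rightarrow> real \<Rightarrow> real \<Rightarrow> real \<Rightarrow> (real \<Rightarrow> real) \<Rightarrow> (real \<Rightarrow> real ^ 5) \<Rightarrow> bool" where
  "weak_EL_stable_constrained M \<mu> \<eta> \<nu> p Vbar \<longleftrightarrow>
    (\<forall>\<xi> lam. Re lam > 0 \<longrightarrow>
      \<not> (\<exists>Vhat. decaying_normal_mode M \<mu> \<eta> \<nu> p Vbar \<xi> lam Vhat \<and>
                transformed_constraint \<xi> Vhat))"

definition strong_EL_stable_constrained ::
  "mhd_model \<Rightarrow> real \<Rightarrow> real \<Rightarrow> real \<Rightarrow> (real \<Rightarrow> real) \<Rightarrow> (real \<Rightarrow> real ^ 5) \<Rightarrow> bool" where
  "strong_EL_stable_constrained M \<mu> \<eta> \<nu> p Vbar \<longleftrightarrow>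
    (\<forall>\<xi> lam. Re lam \<ge> 0 \<and> (\<xi>, lam) \<noteq> (0, 0) \<longrightarrow>
      \<not> (\<exists>Vhat. decaying_normal_mode M \<mu> \<eta> \<nu> p Vbar \<xi> lam Vhat \<and>
                transformed_constraint \<xi> Vhat))"

end

theory Submission
  imports Defs
begin

text \<open>
  Every decaying normal mode with \<open>Re \<lambda> \<ge> 0\<close>, \<open>(\<xi>, \<lambda>) \<noteq> (0, 0)\<close> satisfies the constraint.  Taking the
  divergence of the magnetic equations eliminates the curl term, so \<open>\<phi> = h\<^sub>1' + i \<xi> h\<^sub>2\<close> and
  the flux \<open>G = \<nu> \<phi>' - b \<phi>\<close> satisfy \<open>G' = k \<phi>\<close> with
  \<open>b = \<beta> + \<kappa> u\<^sub>1\<close>, \<open>k = \<lambda> + \<nu> \<xi>\<^sup>2 + i \<xi> \<kappa> u\<^sub>2\<close>, where \<open>\<kappa> = 1\<close> for the hybrid model and \<open>\<kappa> = 0\<close> otherwise.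
  The first magnetic equation has the form \<open>\<nu> h\<^sub>1'' = b h\<^sub>1' + o(1)\<close>, hence \<open>h\<^sub>1' \<rightarrow> 0\<close> and \<open>\<phi> \<rightarrow> 0\<close> at
  both ends.  Since \<open>Re k \<ge> 0\<close>, a one-dimensional form of Kato's inequality for \<open>\<bar>\<phi>\<bar>\<close> forces \<open>Re (cnj \<phi> G)\<close>
  to vanish identically; then so does \<open>G\<close>, hence \<open>k \<phi> = 0\<close>, and \<open>k\<close> has no zero.
\<close>

section \<open>First variations of families of functions of the plane\<close>

definition has_partials ::
  "(real \<Rightarrow> real \<Rightarrow> real) \<Rightarrow> (real \<Rightarrow> real \<Rightarrow> real) \<Rightarrow> (real \<Rightarrow> real \<Rightarrow> real) \<Rightarrow> bool" where
  "has_partials f f1 f2 \<longleftrightarrow>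
    (\<forall>y1 y2. ((\<lambda>y. f y y2) has_real_derivative f1 y1 y2) (at y1) \<and>
             ((\<lambda>y. f y1 y) has_real_derivative f2 y1 y2) (at y2))"

text \<open>
  \<open>has_variation e k f f'\<close>: \<open>f'\<close> is the derivative of the family \<open>f \<epsilon>\<close> at \<open>\<epsilon> = 0\<close>, and
  \<open>\<partial>\<^sub>\<epsilon>\<close> at \<open>0\<close> commutes with all partial derivatives in \<open>(y1, y2)\<close> of order at most \<open>k\<close>.  The partial
  derivatives of \<open>f \<epsilon>\<close> are only required to exist for \<open>\<bar>\<epsilon>\<bar> < e\<close>, but then on the whole plane, which
  keeps the notion closed under \<open>d1\<close> and \<open>d2\<close>.
\<close>

primrec has_variation ::
  "real \<Rightarrow> nat \<Rightarrow> (real \<Rightarrow> real \<Rightarrow> real \<Rightarrow> real) \<Rightarrow> (real \<Rightarrow> real \<Rightarrow> real) \<Rightarrow> bool" where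
  "has_variation e 0 f f' \<longleftrightarrow>
    (\<forall>y1 y2. ((\<lambda>\<epsilon>. f \<epsilon> y1 y2) has_real_derivative f' y1 y2) (at 0))"
| "has_variation e (Suc k) f f' \<longleftrightarrow>
    (\<forall>y1 y2. ((\<lambda>\<epsilon>. f \<epsilon> y1 y2) has_real_derivative f' y1 y2) (at 0)) \<and>
    (\<exists>f1 f2 f1' f2'. (\<forall>\<epsilon>. \<bar>\<epsilon>\<bar> < e \<longrightarrow> has_partials (f \<epsilon>) (f1 \<epsilon>) (f2 \<epsilon>)) \<and>
       has_partials f' f1' f2' \<and> has_variation e k f1 f1' \<and> has_variation e k f2 f2')"

lemma has_variation_0:
  "has_variation e k f f' \<Longrightarrow> ((\<lambda>\<epsilon>. f \<epsilon> y1 y2) has_real_derivative f' y1 y2) (at 0)"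
  by (cases k) auto

lemma has_variation_Suc:
  "has_variation e (Suc k) f f' \<longleftrightarrow> has_variation e 0 f f' \<and>
    (\<exists>f1 f2 f1' f2'. (\<forall>\<epsilon>. \<bar>\<epsilon>\<bar> < e \<longrightarrow> has_partials (f \<epsilon>) (f1 \<epsilon>) (f2 \<epsilon>)) \<and>
       has_partials f' f1' f2' \<and> has_variation e k f1 f1' \<and> has_variation e k f2 f2')"
  by simp

declare has_variation.simps(2) [simp del]

lemma has_variation_SucD: "has_variation e (Suc k) f f' \<Longrightarrow> has_variation e k f f'"
proof (induction k arbitrary: f f')
  case 0
  then show ?case by (simp add: has_variation_Suc)
next
  case (Suc k)
  from Suc.prems show ?case
    unfolding has_variation_Suc [of e "Suc k"] has_variation_Suc [of e k f]
    using Suc.IH by blast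
qed

text \<open>\<open>has_variation\<close> constrains partial derivatives only for parameters below
  \<open>e\<close>, so \<open>d1 (f \<epsilon>)\<close> is identified with
  \<open>f1 \<epsilon>\<close> only there. Since \<open>e > 0\<close>, this covers a neighbourhood
  of 0, which is all that a derivative at 0 sees.\<close>

lemma has_variation_cong:
  assumes "e > 0" "\<And>\<epsilon>. \<bar>\<epsilon>\<bar> < e \<Longrightarrow> f \<epsilon> = g \<epsilon>" "has_variation e k f f'"
  shows "has_variation e k g f'"
proof -
  have *: "eventually (\<lambda>\<epsilon>. \<bar>\<epsilon>\<bar> < e) (nhds (0::real))"
    using \<open>e > 0\<close> eventually_nhds_metric by fastforce
  have 0: "((\<lambda>\<epsilon>. g \<epsilon> y1 y2) has_real_derivative f' y1 y2) (at 0)" for y1 y2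
  proof -
    have "eventually (\<lambda>\<epsilon>. g \<epsilon> y1 y2 = f \<epsilon> y1 y2) (nhds 0)"
      using * by eventually_elim (simp add: assms(2))
    then show ?thesis
      using has_variation_0 [OF assms(3), of y1 y2] by (simp add: DERIV_cong_ev)
  qed
  show ?thesis
  proof (cases k)
    case (Suc n)
    with assms(3) obtain f1 f2 f1' f2' where
      "\<forall>\<epsilon>. \<bar>\<epsilon>\<bar> < e \<longrightarrow> has_partials (f \<epsilon>) (f1 \<epsilon>) (f2 \<epsilon>)"
      "has_partials f' f1' f2'" "has_variation e n f1 f1'" "has_variation e n f2 f2'"
      by (auto simp: has_variation_Suc)
    then show ?thesis
      using 0 assms(2) unfolding Suc has_variation_Suc by auto
  qed (use 0 in simp)
qed

lemma has_partials_d1: "has_partials f f1 f2 \<Longrightarrow> d1 f = f1"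
  unfolding has_partials_def d1_def by (intro ext DERIV_imp_deriv) auto

lemma has_partials_d2: "has_partials f f1 f2 \<Longrightarrow> d2 f = f2"
  unfolding has_partials_def d2_def by (intro ext DERIV_imp_deriv) auto

text \<open>One order is spent on exchanging the parameter derivative at 0 with the partial
  derivative in \<open>y1\<close>. This exchange is what linearizes the differential terms of
  \<open>mhd_op\<close>.\<close>

lemma has_variation_d1:
  assumes "e > 0" "has_variation e (Suc k) f f'"
  shows "has_variation e k (\<lambda>\<epsilon>. d1 (f \<epsilon>)) (d1 f')"
proof -
  obtain f1 f2 f1' f2' where f: "\<forall>\<epsilon>. \<bar>\<epsilon>\<bar> < e \<longrightarrow> has_partials (f \<epsilon>) (f1 \<epsilon>) (f2 \<epsilon>)"
      "has_partials f' f1' f2'" "has_variation e k f1 f1'"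
    using assms(2) by (auto simp: has_variation_Suc)
  then show ?thesis
    using has_variation_cong [OF assms(1) _ f(3)] has_partials_d1 by metis
qed

lemma has_variation_d2:
  assumes "e > 0" "has_variation e (Suc k) f f'"
  shows "has_variation e k (\<lambda>\<epsilon>. d2 (f \<epsilon>)) (d2 f')"
proof -
  obtain f1 f2 f1' f2' where f: "\<forall>\<epsilon>. \<bar>\<epsilon>\<bar> < e \<longrightarrow> has_partials (f \<epsilon>) (f1 \<epsilon>) (f2 \<epsilon>)"
      "has_partials f' f1' f2'" "has_variation e k f2 f2'"
    using assms(2) by (auto simp: has_variation_Suc)
  then show ?thesis
    using has_variation_cong [OF assms(1) _ f(3)] has_partials_d2 by metis
qed

section \<open>Calculus rules for first variations\<close>

lemma has_variation_add:
  assumes "has_variation e k f f'" "has_variation e k g g'"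
  shows "has_variation e k (\<lambda>\<epsilon> y1 y2. f \<epsilon> y1 y2 + g \<epsilon> y1 y2) (\<lambda>y1 y2. f' y1 y2 + g' y1 y2)"
  using assms
proof (induction k arbitrary: f f' g g')
  case (Suc k)
  from Suc.prems(1) obtain f1 f2 f1' f2' where f:
    "\<forall>\<epsilon>. \<bar>\<epsilon>\<bar> < e \<longrightarrow> has_partials (f \<epsilon>) (f1 \<epsilon>) (f2 \<epsilon>)" "has_partials f' f1' f2'"
    "has_variation e k f1 f1'" "has_variation e k f2 f2'"
    by (auto simp: has_variation_Suc)
  from Suc.prems(2) obtain g1 g2 g1' g2' where g:
    "\<forall>\<epsilon>. \<bar>\<epsilon>\<bar> < e \<longrightarrow> has_partials (g \<epsilon>) (g1 \<epsilon>) (g2 \<epsilon>)" "has_partials g' g1' g2'"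
    "has_variation e k g1 g1'" "has_variation e k g2 g2'"
    by (auto simp: has_variation_Suc)
  have 0: "has_variation e 0 (\<lambda>\<epsilon> y1 y2. f \<epsilon> y1 y2 + g \<epsilon> y1 y2) (\<lambda>y1 y2. f' y1 y2 + g' y1 y2)"
    using has_variation_0 [OF Suc.prems(1)] has_variation_0 [OF Suc.prems(2)]
    by (auto intro!: derivative_eq_intros)
  show ?case
    unfolding has_variation_Suc
    apply (rule conjI[OF 0])
    apply (rule exI[of _ "\<lambda>\<epsilon> y1 y2. f1 \<epsilon> y1 y2 + g1 \<epsilon> y1 y2"])
    apply (rule exI[of _ "\<lambda>\<epsilon> y1 y2. f2 \<epsilon> y1 y2 + g2 \<epsilon> y1 y2"])
    apply (rule exI[of _ "\<lambda>y1 y2. f1' y1 y2 + g1' y1 y2"])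
    apply (rule exI[of _ "\<lambda>y1 y2. f2' y1 y2 + g2' y1 y2"])
    using f g Suc.IH by (auto simp: has_partials_def intro!: derivative_eq_intros)
qed (auto intro!: derivative_eq_intros)

lemma has_variation_mult:
  assumes "e > 0" "has_variation e k f f'" "has_variation e k g g'"
  shows "has_variation e k (\<lambda>\<epsilon> y1 y2. f \<epsilon> y1 y2 * g \<epsilon> y1 y2)
    (\<lambda>y1 y2. f' y1 y2 * g 0 y1 y2 + f 0 y1 y2 * g' y1 y2)"
  using assms(2-)
proof (induction k arbitrary: f f' g g')
  case (Suc k)
  from Suc.prems(1) obtain f1 f2 f1' f2' where f:
    "\<forall>\<epsilon>. \<bar>\<epsilon>\<bar> < e \<longrightarrow> has_partials (f \<epsilon>) (f1 \<epsilon>) (f2 \<epsilon>)" "has_partials f' f1' f2'"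
    "has_variation e k f1 f1'" "has_variation e k f2 f2'"
    by (auto simp: has_variation_Suc)
  from Suc.prems(2) obtain g1 g2 g1' g2' where g:
    "\<forall>\<epsilon>. \<bar>\<epsilon>\<bar> < e \<longrightarrow> has_partials (g \<epsilon>) (g1 \<epsilon>) (g2 \<epsilon>)" "has_partials g' g1' g2'"
    "has_variation e k g1 g1'" "has_variation e k g2 g2'"
    by (auto simp: has_variation_Suc)
  have f0: "has_partials (f 0) (f1 0) (f2 0)" and g0: "has_partials (g 0) (g1 0) (g2 0)"
    using f g \<open>e > 0\<close> by auto
  \<comment> \<open>The partial derivatives of a product contain the undifferentiated factors, which
    are therefore needed at order \<open>k\<close> as well.\<close>
  note fk = has_variation_SucD [OF Suc.prems(1)] and gk = has_variation_SucD [OF Suc.prems(2)]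
  have 0: "has_variation e 0 (\<lambda>\<epsilon> y1 y2. f \<epsilon> y1 y2 * g \<epsilon> y1 y2)
      (\<lambda>y1 y2. f' y1 y2 * g 0 y1 y2 + f 0 y1 y2 * g' y1 y2)"
    using has_variation_0 [OF Suc.prems(1)] has_variation_0 [OF Suc.prems(2)]
    by (auto intro!: derivative_eq_intros)
  show ?case
    unfolding has_variation_Suc
    apply (rule conjI[OF 0])
    apply (rule exI[of _ "\<lambda>\<epsilon> y1 y2. f1 \<epsilon> y1 y2 * g \<epsilon> y1 y2 + f \<epsilon> y1 y2 * g1 \<epsilon> y1 y2"])
    apply (rule exI[of _ "\<lambda>\<epsilon> y1 y2. f2 \<epsilon> y1 y2 * g \<epsilon> y1 y2 + f \<epsilon> y1 y2 * g2 \<epsilon> y1 y2"])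
    apply (rule exI[of _ "\<lambda>y1 y2. (f1' y1 y2 * g 0 y1 y2 + f1 0 y1 y2 * g' y1 y2) +
      (f' y1 y2 * g1 0 y1 y2 + f 0 y1 y2 * g1' y1 y2)"])
    apply (rule exI[of _ "\<lambda>y1 y2. (f2' y1 y2 * g 0 y1 y2 + f2 0 y1 y2 * g' y1 y2) +
      (f' y1 y2 * g2 0 y1 y2 + f 0 y1 y2 * g2' y1 y2)"])
    apply (intro conjI has_variation_add Suc.IH f g fk gk)
    using f(1,2) g(1,2) f0 g0
    by (auto simp: has_partials_def intro!: derivative_eq_intros)
qed (auto intro!: derivative_eq_intros)

lemma has_variation_const: "has_variation e k (\<lambda>\<epsilon> y1 y2. c) (\<lambda>y1 y2. 0)"
proof (induction k arbitrary: c)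
  case (Suc k)
  show ?case
    unfolding has_variation_Suc
    by (intro conjI exI[of _ "\<lambda>\<epsilon> y1 y2. 0"] exI[of _ "\<lambda>y1 y2. 0"] Suc.IH)
      (auto simp: has_partials_def intro!: derivative_eq_intros)
qed auto

lemma has_variation_cmult:
  assumes "e > 0" "has_variation e k f f'"
  shows "has_variation e k (\<lambda>\<epsilon> y1 y2. c * f \<epsilon> y1 y2) (\<lambda>y1 y2. c * f' y1 y2)"
  using has_variation_mult [OF assms(1) has_variation_const assms(2), of c] by simp

lemma has_variation_minus:
  assumes "e > 0" "has_variation e k f f'"
  shows "has_variation e k (\<lambda>\<epsilon> y1 y2. - f \<epsilon> y1 y2) (\<lambda>y1 y2. - f' y1 y2)"
  using has_variation_cmult [OF assms, of "-1"] by simp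

lemma has_variation_diff:
  assumes "e > 0" "has_variation e k f f'" "has_variation e k g g'"
  shows "has_variation e k (\<lambda>\<epsilon> y1 y2. f \<epsilon> y1 y2 - g \<epsilon> y1 y2) (\<lambda>y1 y2. f' y1 y2 - g' y1 y2)"
  using has_variation_add [OF assms(2) has_variation_minus [OF assms(1,3)]] by simp

lemma smooth_fun_on_deriv: "smooth_fun_on S f \<Longrightarrow> smooth_fun_on S (deriv f)"
  unfolding smooth_fun_on_def by (metis funpow_Suc_right comp_apply)

lemma smooth_fun_on_DERIV:
  assumes "smooth_fun_on S f" "open S" "x \<in> S"
  shows "(f has_real_derivative deriv f x) (at x)"
proof -
  have "f differentiable_on S"
    using assms(1) unfolding smooth_fun_on_def by (metis funpow_0)
  then show ?thesis
    using assms(2,3)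
    by (metis DERIV_deriv_iff_real_differentiable differentiable_on_def at_within_open)
qed

text \<open>The partial derivatives of \<open>p (f \<epsilon>)\<close> involve
  \<open>deriv p (f \<epsilon>)\<close>, so the induction on the order runs over all smooth
  \<open>p\<close>. Positivity of \<open>f \<epsilon>\<close> keeps the argument inside the domain
  of smoothness. The rule serves the pressure term.\<close>

lemma has_variation_compose:
  assumes "e > 0" "has_variation e k f f'" "\<And>\<epsilon> y1 y2. \<bar>\<epsilon>\<bar> < e \<Longrightarrow> f \<epsilon> y1 y2 > 0"
    and "smooth_fun_on {0<..} p"
  shows "has_variation e k (\<lambda>\<epsilon> y1 y2. p (f \<epsilon> y1 y2)) (\<lambda>y1 y2. deriv p (f 0 y1 y2) * f' y1 y2)"
  using assms(2,4)
proof (induction k arbitrary: p)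
  case 0
  then show ?case
    using assms(1,3)
    by (auto intro!: DERIV_chain2 [OF smooth_fun_on_DERIV [OF 0(2) open_greaterThan]])
next
  case (Suc k)
  note S = smooth_fun_on_deriv [OF Suc.prems(2)]
  have p1: "(p has_real_derivative deriv p x) (at x)" if "x > 0" for x
    using smooth_fun_on_DERIV [OF Suc.prems(2) open_greaterThan] that by simp
  have p2: "(deriv p has_real_derivative deriv (deriv p) x) (at x)" if "x > 0" for x
    using smooth_fun_on_DERIV [OF S open_greaterThan] that by simp
  from Suc.prems(1) obtain f1 f2 f1' f2' where f:
    "\<forall>\<epsilon>. \<bar>\<epsilon>\<bar> < e \<longrightarrow> has_partials (f \<epsilon>) (f1 \<epsilon>) (f2 \<epsilon>)" "has_partials f' f1' f2'"
    "has_variation e k f1 f1'" "has_variation e k f2 f2'"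
    by (auto simp: has_variation_Suc)
  have f0: "has_partials (f 0) (f1 0) (f2 0)" using f \<open>e > 0\<close> by auto
  have pos0: "f 0 y1 y2 > 0" for y1 y2 using assms(1,3) by simp
  note pk = Suc.IH [OF has_variation_SucD [OF Suc.prems(1)] S]
  have 0: "has_variation e 0 (\<lambda>\<epsilon> y1 y2. p (f \<epsilon> y1 y2)) (\<lambda>y1 y2. deriv p (f 0 y1 y2) * f' y1 y2)"
    using has_variation_0 [OF Suc.prems(1)] pos0 by (auto intro!: DERIV_chain2 [OF p1])
  show ?case
    unfolding has_variation_Suc
    apply (rule conjI[OF 0])
    apply (rule exI[of _ "\<lambda>\<epsilon> y1 y2. deriv p (f \<epsilon> y1 y2) * f1 \<epsilon> y1 y2"])
    apply (rule exI[of _ "\<lambda>\<epsilon> y1 y2. deriv p (f \<epsilon> y1 y2) * f2 \<epsilon> y1 y2"])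
    apply (rule exI[of _ "\<lambda>y1 y2. (deriv (deriv p) (f 0 y1 y2) * f' y1 y2) * f1 0 y1 y2 +
      deriv p (f 0 y1 y2) * f1' y1 y2"])
    apply (rule exI[of _ "\<lambda>y1 y2. (deriv (deriv p) (f 0 y1 y2) * f' y1 y2) * f2 0 y1 y2 +
      deriv p (f 0 y1 y2) * f2' y1 y2"])
    apply (intro conjI has_variation_mult pk f \<open>e > 0\<close>)
    using f(1,2) f0 pos0 assms(3)
    by (auto simp: has_partials_def
        intro!: derivative_eq_intros DERIV_chain2 [OF p1] DERIV_chain2 [OF p2])
qed

text \<open>Partial derivatives of \<open>inverse (f \<epsilon>)\<close> are products of
  \<open>inverse (f \<epsilon>)\<close> with itself and with those of \<open>f \<epsilon>\<close>,
  so the product rule at the lower order closes the induction. Products instead of quotients let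
  \<open>has_variation_mult\<close> and \<open>has_variation_minus\<close> produce the variation
  literally.\<close>

lemma has_variation_inverse:
  assumes "e > 0" "has_variation e k f f'" "\<And>\<epsilon> y1 y2. \<bar>\<epsilon>\<bar> < e \<Longrightarrow> f \<epsilon> y1 y2 \<noteq> 0"
  shows "has_variation e k (\<lambda>\<epsilon> y1 y2. inverse (f \<epsilon> y1 y2))
    (\<lambda>y1 y2. - (f' y1 y2 * (inverse (f 0 y1 y2) * inverse (f 0 y1 y2))))"
  using assms(2)
proof (induction k)
  case 0
  then show ?case using assms(1) assms(3) [of 0]
    by (auto intro!: derivative_eq_intros simp: field_simps)
next
  case (Suc k)
  from Suc.prems(1) obtain f1 f2 f1' f2' where f:
    "\<forall>\<epsilon>. \<bar>\<epsilon>\<bar> < e \<longrightarrow> has_partials (f \<epsilon>) (f1 \<epsilon>) (f2 \<epsilon>)" "has_partials f' f1' f2'"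
    "has_variation e k f1 f1'" "has_variation e k f2 f2'"
    by (auto simp: has_variation_Suc)
  have f0: "has_partials (f 0) (f1 0) (f2 0)" using f \<open>e > 0\<close> by auto
  have nz0: "f 0 y1 y2 \<noteq> 0" for y1 y2 using assms(1,3) by simp
  let ?i = "\<lambda>\<epsilon> y1 y2. inverse (f \<epsilon> y1 y2)"
  let ?i' = "\<lambda>y1 y2. - (f' y1 y2 * (inverse (f 0 y1 y2) * inverse (f 0 y1 y2)))"
  note ik = Suc.IH [OF has_variation_SucD [OF Suc.prems(1)]]
  have 0: "has_variation e 0 ?i ?i'"
    using has_variation_0[OF Suc.prems(1)] nz0
    by (auto intro!: derivative_eq_intros simp: field_simps)
  show ?case
    unfolding has_variation_Suc
    apply (rule conjI[OF 0])
    apply (rule exI[of _ "\<lambda>\<epsilon> y1 y2. - (f1 \<epsilon> y1 y2 * (?i \<epsilon> y1 y2 * ?i \<epsilon> y1 y2))"])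
    apply (rule exI[of _ "\<lambda>\<epsilon> y1 y2. - (f2 \<epsilon> y1 y2 * (?i \<epsilon> y1 y2 * ?i \<epsilon> y1 y2))"])
    apply (rule exI[of _ "\<lambda>y1 y2. - (f1' y1 y2 * (?i 0 y1 y2 * ?i 0 y1 y2) +
       f1 0 y1 y2 * (?i' y1 y2 * ?i 0 y1 y2 + ?i 0 y1 y2 * ?i' y1 y2))"])
    apply (rule exI[of _ "\<lambda>y1 y2. - (f2' y1 y2 * (?i 0 y1 y2 * ?i 0 y1 y2) +
       f2 0 y1 y2 * (?i' y1 y2 * ?i 0 y1 y2 + ?i 0 y1 y2 * ?i' y1 y2))"])
    apply (intro conjI has_variation_minus has_variation_mult ik f \<open>e > 0\<close>)
    using f(1,2) f0 nz0 assms(3)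
    by (auto simp: has_partials_def field_simps intro!: derivative_eq_intros)
qed

lemma has_variation_divide:
  assumes "e > 0" "has_variation e k f f'" "has_variation e k g g'"
    and "\<And>\<epsilon> y1 y2. \<bar>\<epsilon>\<bar> < e \<Longrightarrow> g \<epsilon> y1 y2 \<noteq> 0"
  shows "has_variation e k (\<lambda>\<epsilon> y1 y2. f \<epsilon> y1 y2 / g \<epsilon> y1 y2)
    (\<lambda>y1 y2. f' y1 y2 / g 0 y1 y2 - f 0 y1 y2 * g' y1 y2 / (g 0 y1 y2)\<^sup>2)"
  using has_variation_mult [OF assms(1,2) has_variation_inverse [OF assms(1,3,4)]]
  by (simp add: divide_inverse power2_eq_square mult.assoc)

text \<open>A perturbation that is affine in the parameter has partial derivatives of the same kind,
  so order \<open>Suc k\<close> reduces to order \<open>k\<close> for the differentiated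
  coefficients.\<close>

lemma has_variation_affine:
  "has_variation e 0 (\<lambda>\<epsilon> y1 y2. a y1 y2 + \<epsilon> * b y1 y2) b"
  "has_partials a a1 a2 \<Longrightarrow> has_partials b b1 b2 \<Longrightarrow>
   has_variation e k (\<lambda>\<epsilon> y1 y2. a1 y1 y2 + \<epsilon> * b1 y1 y2) b1 \<Longrightarrow>
   has_variation e k (\<lambda>\<epsilon> y1 y2. a2 y1 y2 + \<epsilon> * b2 y1 y2) b2 \<Longrightarrow>
   has_variation e (Suc k) (\<lambda>\<epsilon> y1 y2. a y1 y2 + \<epsilon> * b y1 y2) b"
proof -
  show 0: "has_variation e 0 (\<lambda>\<epsilon> y1 y2. a y1 y2 + \<epsilon> * b y1 y2) b"
    by (auto intro!: derivative_eq_intros)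
  assume *: "has_partials a a1 a2" "has_partials b b1 b2"
    "has_variation e k (\<lambda>\<epsilon> y1 y2. a1 y1 y2 + \<epsilon> * b1 y1 y2) b1"
    "has_variation e k (\<lambda>\<epsilon> y1 y2. a2 y1 y2 + \<epsilon> * b2 y1 y2) b2"
  show "has_variation e (Suc k) (\<lambda>\<epsilon> y1 y2. a y1 y2 + \<epsilon> * b y1 y2) b"
    unfolding has_variation_Suc
    apply (rule conjI[OF 0])
    apply (rule exI[of _ "\<lambda>\<epsilon> y1 y2. a1 y1 y2 + \<epsilon> * b1 y1 y2"])
    apply (rule exI[of _ "\<lambda>\<epsilon> y1 y2. a2 y1 y2 + \<epsilon> * b2 y1 y2"])
    apply (rule exI[of _ b1], rule exI[of _ b2])
    using * by (auto simp: has_partials_def intro!: derivative_eq_intros)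
qed

section \<open>The equation for the transformed divergence\<close>

text \<open>Integrating factor: for an antiderivative \<open>g\<close> of \<open>c\<close>, the
  product \<open>exp (- g x) * y x\<close> is nondecreasing on \<open>{a..b}\<close> and hence stays
  positive.\<close>

lemma differential_inequality_pos:
  fixes y c :: "real \<Rightarrow> real"
  assumes y: "\<And>x. x \<ge> a \<Longrightarrow> (y has_real_derivative y' x) (at x)"
    and c: "continuous_on UNIV c" and ge: "\<And>x. x \<ge> a \<Longrightarrow> y' x \<ge> c x * y x"
    and "y a > 0" "a \<le> b"
  shows "y b > 0"
proof -
  obtain g where g: "\<And>x. x \<in> {a..b} \<Longrightarrow> (g has_vector_derivative c x) (at x within {a..b})"
    using antiderivative_continuous continuous_on_subset [OF c subset_UNIV] by metis
  have g': "(g has_real_derivative c x) (at x within {a..b})" if "x \<in> {a..b}" for x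
    using g [OF that] by (simp add: has_real_derivative_iff_has_vector_derivative)
  let ?z = "\<lambda>x. exp (- g x) * y x"
  have der: "(?z has_real_derivative exp (- g x) * (y' x - c x * y x)) (at x within {a..b})"
    if "x \<in> {a..b}" for x
  proof -
    have "(y has_real_derivative y' x) (at x within {a..b})"
      by (rule has_field_derivative_at_within [OF y]) (use that in simp)
    from DERIV_mult [OF DERIV_chain2 [OF DERIV_exp DERIV_minus [OF g' [OF that]]] this]
    show ?thesis by (rule DERIV_cong) (simp add: algebra_simps)
  qed
  have "?z a \<le> ?z b"
  proof (rule DERIV_nonneg_imp_increasing_open [OF \<open>a \<le> b\<close>])
    fix x assume x: "a < x" "x < b"
    then have "(?z has_real_derivative exp (- g x) * (y' x - c x * y x)) (at x)"
      using der [of x] by (simp add: at_within_Icc_at)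
    moreover have "0 \<le> exp (- g x) * (y' x - c x * y x)"
      using x ge by simp
    ultimately show "\<exists>d. (?z has_real_derivative d) (at x) \<and> 0 \<le> d" by blast
  next
    show "continuous_on {a..b} ?z"
      by (rule DERIV_continuous_on [OF der])
  qed
  moreover have "?z a > 0" using \<open>y a > 0\<close> by simp
  ultimately have "?z b > 0" by linarith
  then show ?thesis by (simp add: zero_less_mult_iff)
qed

text \<open>The two functions are \<open>Re (cnj \<phi> * G)\<close> and the squared modulus of
  \<open>\<phi>\<close>, differentiated along the system
  \<open>\<nu> \<phi>' = G + c \<phi>\<close>, \<open>G' = k \<phi>\<close>. Only
  \<open>Re k\<close> enters, because \<open>cnj \<phi> * k * \<phi>\<close> is \<open>k\<close>
  times a real number.\<close>

lemma pairing_DERIV: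
  fixes \<phi> G k :: "real \<Rightarrow> complex" and c :: "real \<Rightarrow> real"
  assumes "\<nu> > 0"
    and \<phi>: "\<And>x. (\<phi> has_vector_derivative (G x + of_real (c x) * \<phi> x) / of_real \<nu>) (at x)"
    and G: "\<And>x. (G has_vector_derivative k x * \<phi> x) (at x)"
  shows "((\<lambda>x. Re (\<phi> x) * Re (G x) + Im (\<phi> x) * Im (G x)) has_real_derivative
      ((Re (G x))\<^sup>2 + (Im (G x))\<^sup>2 + c x * (Re (\<phi> x) * Re (G x) + Im (\<phi> x) * Im (G x))) / \<nu>
      + Re (k x) * ((Re (\<phi> x))\<^sup>2 + (Im (\<phi> x))\<^sup>2)) (at x)" (is ?P)
    and "((\<lambda>x. (Re (\<phi> x))\<^sup>2 + (Im (\<phi> x))\<^sup>2) has_real_derivative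
      2 * ((Re (\<phi> x) * Re (G x) + Im (\<phi> x) * Im (G x)) +
        c x * ((Re (\<phi> x))\<^sup>2 + (Im (\<phi> x))\<^sup>2)) / \<nu>) (at x)" (is ?s)
proof -
  have R\<phi>: "((\<lambda>x. Re (\<phi> x)) has_real_derivative (Re (G x) + c x * Re (\<phi> x)) / \<nu>) (at x)"
    using bounded_linear.has_vector_derivative [OF bounded_linear_Re \<phi>]
    by (simp add: has_real_derivative_iff_has_vector_derivative)
  have I\<phi>: "((\<lambda>x. Im (\<phi> x)) has_real_derivative (Im (G x) + c x * Im (\<phi> x)) / \<nu>) (at x)"
    using bounded_linear.has_vector_derivative [OF bounded_linear_Im \<phi>]
    by (simp add: has_real_derivative_iff_has_vector_derivative)
  have RG: "((\<lambda>x. Re (G x)) has_real_derivative Re (k x * \<phi> x)) (at x)"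
    using bounded_linear.has_vector_derivative [OF bounded_linear_Re G]
    by (simp add: has_real_derivative_iff_has_vector_derivative)
  have IG: "((\<lambda>x. Im (G x)) has_real_derivative Im (k x * \<phi> x)) (at x)"
    using bounded_linear.has_vector_derivative [OF bounded_linear_Im G]
    by (simp add: has_real_derivative_iff_has_vector_derivative)
  show ?P
    by (rule DERIV_cong [OF DERIV_add [OF DERIV_mult [OF R\<phi> RG] DERIV_mult [OF I\<phi> IG]]])
      (use \<open>\<nu> > 0\<close> in \<open>simp add: divide_simps, simp add: algebra_simps power2_eq_square\<close>)
  show ?s
    by (rule DERIV_cong [OF DERIV_add [OF DERIV_power [OF R\<phi>, of 2] DERIV_power [OF I\<phi>, of 2]]])
      (use \<open>\<nu> > 0\<close> in \<open>simp add: divide_simps, simp add: algebra_simps power2_eq_square\<close>)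
qed

lemma DERIV_sqrt_eq:
  assumes "(s has_real_derivative s') (at x)" "s x > 0"
  shows "((\<lambda>x. sqrt (s x)) has_real_derivative s' / (2 * sqrt (s x))) (at x)"
  using assms by (auto intro!: derivative_eq_intros simp: field_simps)

text \<open>
  As long as \<open>Re (cnj \<phi> G)\<close> is positive, \<open>w = \<bar>\<phi>\<bar>\<close> satisfies \<open>\<nu> w' = c w + g\<close> with
  \<open>g = Re (cnj \<phi> G) / w\<close> nondecreasing, so \<open>w\<close> cannot tend to \<open>0\<close>.
\<close>

lemma flux_pairing_nonpos:
  fixes \<phi> G k :: "real \<Rightarrow> complex" and c :: "real \<Rightarrow> real"
  assumes "\<nu> > 0"
    and \<phi>: "\<And>x. (\<phi> has_vector_derivative (G x + of_real (c x) * \<phi> x) / of_real \<nu>) (at x)"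
    and G: "\<And>x. (G has_vector_derivative k x * \<phi> x) (at x)"
    and k: "\<And>x. Re (k x) \<ge> 0"
    and c: "continuous_on UNIV c" "(c \<longlongrightarrow> cp) at_top"
    and lim: "(\<phi> \<longlongrightarrow> 0) at_top"
  shows "Re (cnj (\<phi> a) * G a) \<le> 0"
proof (rule ccontr)
  define P where "P = (\<lambda>x. Re (\<phi> x) * Re (G x) + Im (\<phi> x) * Im (G x))"
  define s where "s = (\<lambda>x. (Re (\<phi> x))\<^sup>2 + (Im (\<phi> x))\<^sup>2)"
  define N where "N = (\<lambda>x. (Re (G x))\<^sup>2 + (Im (G x))\<^sup>2)"
  assume "\<not> ?thesis"
  then have Pa: "P a > 0" by (simp add: P_def)
  have Pd: "(P has_real_derivative (N x + c x * P x) / \<nu> + Re (k x) * s x) (at x)" for x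
    using pairing_DERIV(1) [OF assms(1-3)] unfolding P_def N_def s_def .
  have sd: "(s has_real_derivative 2 * (P x + c x * s x) / \<nu>) (at x)" for x
    using pairing_DERIV(2) [OF assms(1-3)] unfolding P_def s_def .
  have s0: "s x \<ge> 0" and N0: "N x \<ge> 0" for x by (auto simp: s_def N_def)
  \<comment> \<open>Cauchy-Schwarz for \<open>\<phi>\<close> and \<open>G\<close> as vectors in the
    real plane; the defect is the square of their determinant.\<close>
  have cauchy: "(P x)\<^sup>2 \<le> N x * s x" for x
  proof -
    have "N x * s x - (P x)\<^sup>2 = (Re (\<phi> x) * Im (G x) - Im (\<phi> x) * Re (G x))\<^sup>2"
      unfolding P_def s_def N_def by (simp add: algebra_simps power2_eq_square)
    then show ?thesis by (metis diff_ge_0_iff_ge zero_le_power2)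
  qed
  have c\<nu>: "continuous_on UNIV (\<lambda>x. c x / \<nu>)" "continuous_on UNIV (\<lambda>x. 2 * c x / \<nu>)"
    using \<open>\<nu> > 0\<close> by (auto intro!: continuous_intros c)
  \<comment> \<open>Dropping the nonnegative terms \<open>N x / \<nu>\<close> and
    \<open>Re (k x) * s x\<close> leaves \<open>P' \<ge> (c / \<nu>) P\<close>, so positivity at
    \<open>a\<close> persists to the right.\<close>
  have P: "P x > 0" if "x \<ge> a" for x
  proof (rule differential_inequality_pos [OF Pd c\<nu>(1) _ Pa that])
    fix x show "c x / \<nu> * P x \<le> (N x + c x * P x) / \<nu> + Re (k x) * s x"
      using N0 [of x] s0 [of x] k [of x] \<open>\<nu> > 0\<close> by (simp add: add_divide_distrib)
  qed
  have "\<phi> a \<noteq> 0" using Pa by (auto simp: P_def)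
  then have sa: "s a > 0"
    unfolding s_def by (simp add: complex_eq_iff sum_power2_gt_zero_iff)
  \<comment> \<open>Positivity of \<open>P\<close> gives \<open>s' \<ge> (2 c / \<nu>) s\<close>;
    thus \<open>\<phi>\<close> has no zero to the right of \<open>a\<close>, and the modulus
    \<open>w\<close> is differentiable there.\<close>
  have s: "s x > 0" if "x \<ge> a" for x
  proof (rule differential_inequality_pos [OF sd c\<nu>(2) _ sa that])
    fix x assume "a \<le> x"
    then show "2 * c x / \<nu> * s x \<le> 2 * (P x + c x * s x) / \<nu>"
      using P [of x] \<open>\<nu> > 0\<close> by (simp add: field_simps)
  qed
  define w where "w = (\<lambda>x. sqrt (s x))"
  define g where "g = (\<lambda>x. P x / w x)"
  have w: "w x > 0" "w x * w x = s x" if "x \<ge> a" for x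
    using s [OF that] by (auto simp: w_def)
  have wd: "(w has_real_derivative (g x + c x * w x) / \<nu>) (at x)" if "x \<ge> a" for x
  proof -
    have "2 * (P x + c x * s x) / \<nu> / (2 * w x) = (g x + c x * w x) / \<nu>"
      using w [OF that] \<open>\<nu> > 0\<close> unfolding g_def by (simp add: divide_simps)
    then show ?thesis
      using DERIV_sqrt_eq [OF sd s [OF that]] unfolding w_def by simp
  qed
  \<comment> \<open>In the derivative of \<open>P / w\<close> the terms with \<open>c\<close>
    cancel. The rest consists of the Cauchy-Schwarz defect and a term with \<open>Re k\<close>, both
    nonnegative.\<close>
  have g_mono: "g a \<le> g x" if "x \<ge> a" for x
  proof (rule DERIV_nonneg_imp_nondecreasing [OF that])
    fix y assume y: "a \<le> y" "y \<le> x"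
    note wy = w [OF y(1)]
    let ?d = "(((N y + c y * P y) / \<nu> + Re (k y) * s y) * w y - P y * ((g y + c y * w y) / \<nu>)) / (w y * w y)"
    have "w y \<noteq> 0" using wy by simp
    then have gd: "(g has_real_derivative ?d) (at y)"
      unfolding g_def [abs_def] by (rule DERIV_divide [OF Pd wd [OF y(1)], unfolded g_def])
    have "?d = ((N y * s y - (P y)\<^sup>2) / (s y * \<nu>) + Re (k y) * s y) / w y"
    proof -
      have "(((n + q * p) / \<nu> + r * (v * v)) * v - p * ((p / v + q * v) / \<nu>)) / (v * v) =
          ((n * (v * v) - p\<^sup>2) / (v * v * \<nu>) + r * (v * v)) / v" if "v > 0" for n p q r v :: real
      proof -
        have "((n + q * p) / \<nu> + r * (v * v)) * v - p * ((p / v + q * v) / \<nu>) =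
            ((n * (v * v) - p\<^sup>2) / (v * v * \<nu>) + r * (v * v)) * v"
          using that \<open>\<nu> > 0\<close> by (simp add: divide_simps) algebra
        then show ?thesis using that by simp
      qed
      from this [OF wy(1), of "N y" "c y" "P y" "Re (k y)"] show ?thesis
        unfolding wy(2) g_def .
    qed
    also have "\<dots> \<ge> 0"
    proof (intro divide_nonneg_pos add_nonneg_nonneg mult_nonneg_nonneg k wy(1) s0)
      show "0 \<le> N y * s y - (P y)\<^sup>2" using cauchy [of y] by simp
      show "0 < s y * \<nu>" using s [OF y(1)] \<open>\<nu> > 0\<close> by simp
    qed
    finally show "\<exists>d. (g has_real_derivative d) (at y) \<and> 0 \<le> d" using gd by blast
  qed
  have ga: "g a > 0" unfolding g_def using Pa w [of a] by simp
  have "w = (\<lambda>x. norm (\<phi> x))"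
    unfolding w_def s_def by (simp add: cmod_def)
  then have wlim: "(w \<longlongrightarrow> 0) at_top" using tendsto_norm [OF lim] by simp
  have "((\<lambda>x. c x * w x) \<longlongrightarrow> 0) at_top"
    using tendsto_mult [OF c(2) wlim] by simp
  then have "\<forall>\<^sub>F x in at_top. c x * w x > - (g a / 2)"
    using ga by (intro order_tendstoD(1)) auto
  moreover have "\<forall>\<^sub>F x in at_top. w x < g a / (2 * \<nu>)"
    using ga \<open>\<nu> > 0\<close> by (intro order_tendstoD(2) [OF wlim]) auto
  ultimately have "\<forall>\<^sub>F x in at_top. c x * w x > - (g a / 2) \<and> w x < g a / (2 * \<nu>)"
    by eventually_elim auto
  then obtain X0 where X0: "\<And>x. x \<ge> X0 \<Longrightarrow> c x * w x > - (g a / 2) \<and> w x < g a / (2 * \<nu>)"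
    by (auto simp: eventually_at_top_linorder)
  \<comment> \<open>Beyond \<open>X\<close> the derivative of \<open>w\<close> exceeds
    \<open>g a / (2 * \<nu>)\<close>. Over a unit interval \<open>w\<close> then grows by more than
    the bound \<open>g a / (2 * \<nu>)\<close> that holds for \<open>w\<close> itself.\<close>
  define X where "X = max a X0"
  have "\<exists>z. z > X \<and> z < X + 1 \<and> w (X + 1) - w X = (X + 1 - X) * ((g z + c z * w z) / \<nu>)"
    by (rule MVT2) (auto intro!: wd simp: X_def)
  then obtain z where z: "z > X" "w (X + 1) - w X = (g z + c z * w z) / \<nu>" by auto
  have "z \<ge> a" "z \<ge> X0" using z(1) by (auto simp: X_def)
  then have "g z + c z * w z > g a / 2" using g_mono [of z] X0 [of z] by linarith
  then have "(g z + c z * w z) / \<nu> > g a / 2 / \<nu>"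
    using \<open>\<nu> > 0\<close> by (rule divide_strict_right_mono)
  moreover have "w X > 0" using w [of X] by (simp add: X_def)
  moreover have "w (X + 1) < g a / (2 * \<nu>)" using X0 [of "X + 1"] by (simp add: X_def)
  ultimately show False using z(2) by simp
qed

lemma has_vector_derivative_mirror:
  fixes f :: "real \<Rightarrow> 'a::real_normed_vector"
  assumes "\<And>x. (f has_vector_derivative f' x) (at x)"
  shows "((\<lambda>x. f (- x)) has_vector_derivative - f' (- x)) (at x)"
proof -
  have "(uminus has_vector_derivative - 1) (at x)"
    by (auto intro!: derivative_eq_intros)
  from vector_diff_chain_at [OF this assms] show ?thesis by (simp add: o_def)
qed

text \<open>Reflecting the axis yields a system of the same form with \<open>G\<close> and
  \<open>c\<close> negated, which reverses the sign of \<open>Re (cnj \<phi> * G)\<close>. The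
  bounds obtained from the two ends make this pairing vanish identically. Its derivative is then a
  sum of two nonnegative terms equal to zero, one of them the squared modulus of \<open>G\<close>
  over \<open>\<nu>\<close>.\<close>

lemma flux_eq_0:
  fixes \<phi> G k :: "real \<Rightarrow> complex" and c :: "real \<Rightarrow> real"
  assumes "\<nu> > 0"
    and \<phi>: "\<And>x. (\<phi> has_vector_derivative (G x + of_real (c x) * \<phi> x) / of_real \<nu>) (at x)"
    and G: "\<And>x. (G has_vector_derivative k x * \<phi> x) (at x)"
    and k: "\<And>x. Re (k x) \<ge> 0"
    and c: "continuous_on UNIV c" "(c \<longlongrightarrow> cp) at_top" "(c \<longlongrightarrow> cm) at_bot"
    and lim: "(\<phi> \<longlongrightarrow> 0) at_top" "(\<phi> \<longlongrightarrow> 0) at_bot"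
  shows "G x = 0"
proof -
  have le: "Re (cnj (\<phi> a) * G a) \<le> 0" for a
    by (rule flux_pairing_nonpos [OF assms(1-6) lim(1)])
  have ge: "Re (cnj (\<phi> a) * G a) \<ge> 0" for a
  proof -
    \<comment> \<open>The reflected system is evaluated at \<open>- a\<close>; the double minus
      makes the claim match the mirrored functions literally.\<close>
    have "Re (cnj (\<phi> (- (- a))) * (- G (- (- a)))) \<le> 0"
    proof (rule flux_pairing_nonpos [where \<nu> = \<nu> and c = "\<lambda>x. - c (- x)" and k = "\<lambda>x. k (- x)"
          and \<phi> = "\<lambda>x. \<phi> (- x)" and G = "\<lambda>x. - G (- x)"])
      fix x
      show "((\<lambda>x. \<phi> (- x)) has_vector_derivative
          (- G (- x) + of_real (- c (- x)) * \<phi> (- x)) / of_real \<nu>) (at x)"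
        using has_vector_derivative_mirror [OF \<phi>, of x] by (simp add: field_simps minus_divide_left)
      show "((\<lambda>x. - G (- x)) has_vector_derivative k (- x) * \<phi> (- x)) (at x)"
        using has_vector_derivative_minus [OF has_vector_derivative_mirror [OF G, of x]] by simp
      show "((\<lambda>x. - c (- x)) \<longlongrightarrow> - cm) at_top"
        using c(3) by (intro tendsto_minus) (simp add: filterlim_at_bot_mirror)
      show "((\<lambda>x. \<phi> (- x)) \<longlongrightarrow> 0) at_top"
        using lim(2) by (simp add: filterlim_at_bot_mirror)
      show "continuous_on UNIV (\<lambda>x. - c (- x))"
        by (intro continuous_intros continuous_on_compose2 [OF c(1)]) auto
    qed (use k \<open>\<nu> > 0\<close> in auto)
    then show ?thesis by simp
  qed
  have P: "(\<lambda>x. Re (\<phi> x) * Re (G x) + Im (\<phi> x) * Im (G x)) = (\<lambda>x. 0)"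
    using le ge by (auto simp: fun_eq_iff intro!: antisym)
  have Px: "Re (\<phi> x) * Re (G x) + Im (\<phi> x) * Im (G x) = 0"
    using P by metis
  let ?d = "((Re (G x))\<^sup>2 + (Im (G x))\<^sup>2 + c x * (Re (\<phi> x) * Re (G x) + Im (\<phi> x) * Im (G x))) / \<nu>
      + Re (k x) * ((Re (\<phi> x))\<^sup>2 + (Im (\<phi> x))\<^sup>2)"
  have "((\<lambda>x. Re (\<phi> x) * Re (G x) + Im (\<phi> x) * Im (G x)) has_real_derivative ?d) (at x)"
    by (rule pairing_DERIV(1) [OF assms(1-3)])
  then have "?d = 0"
    unfolding P by (rule DERIV_unique) simp
  then have "((Re (G x))\<^sup>2 + (Im (G x))\<^sup>2) / \<nu> + Re (k x) * ((Re (\<phi> x))\<^sup>2 + (Im (\<phi> x))\<^sup>2) = 0"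
    unfolding Px by simp
  moreover have "((Re (G x))\<^sup>2 + (Im (G x))\<^sup>2) / \<nu> \<ge> 0" using \<open>\<nu> > 0\<close> by simp
  moreover have "Re (k x) * ((Re (\<phi> x))\<^sup>2 + (Im (\<phi> x))\<^sup>2) \<ge> 0" using k by simp
  ultimately have "((Re (G x))\<^sup>2 + (Im (G x))\<^sup>2) / \<nu> = 0" by linarith
  then show ?thesis using \<open>\<nu> > 0\<close> by (simp add: complex_eq_iff sum_power2_eq_zero_iff)
qed

text \<open>
  If \<open>\<bar>f'\<bar>\<close> is maximal at \<open>z\<close> on an interval of length \<open>d\<close> with \<open>d C \<le> 1/2\<close>, then \<open>f'\<close> varies
  there by at most \<open>\<bar>f' z\<bar> / 2 + d e\<close>, so \<open>\<bar>f' z\<bar>\<close> is controlled by the increment of \<open>f\<close>.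
\<close>

lemma tendsto_0_derivative_at_top:
  fixes f f' r :: "real \<Rightarrow> complex" and c :: "real \<Rightarrow> real"
  assumes f: "\<And>x. (f has_vector_derivative f' x) (at x)"
    and f': "\<And>x. (f' has_vector_derivative of_real (c x) * f' x + r x) (at x)"
    and c: "(c \<longlongrightarrow> cp) at_top" and r: "(r \<longlongrightarrow> 0) at_top" and lim: "(f \<longlongrightarrow> 0) at_top"
  shows "(f' \<longlongrightarrow> 0) at_top"
proof (rule tendstoI)
  fix e :: real assume "e > 0"
  \<comment> \<open>\<open>C\<close> bounds the coefficient near the end, and
    \<open>d * C = 1/2\<close> lets half of the maximum be absorbed. The values \<open>e1\<close>
    and \<open>e2\<close> make the remaining contributions \<open>d * e1\<close> and
    \<open>2 * e2 / d\<close> equal to \<open>e / 8\<close> each.\<close>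
  define C where "C = \<bar>cp\<bar> + 1"
  define d where "d = 1 / (2 * C)"
  have "C > 0" "d > 0" "d * C = 1/2" by (auto simp: C_def d_def)
  define e1 where "e1 = e / (8 * d)"
  define e2 where "e2 = e * d / 16"
  have "e1 > 0" "e2 > 0" using \<open>e > 0\<close> \<open>d > 0\<close> by (auto simp: e1_def e2_def)
  have "\<forall>\<^sub>F x in at_top. \<bar>c x\<bar> < C"
    using tendsto_rabs [OF c] by (rule order_tendstoD) (simp add: C_def)
  moreover have "\<forall>\<^sub>F x in at_top. norm (r x) < e1"
    using tendstoD [OF r \<open>e1 > 0\<close>] by simp
  moreover have "\<forall>\<^sub>F x in at_top. norm (f x) < e2"
    using tendstoD [OF lim \<open>e2 > 0\<close>] by simp
  ultimately have "\<forall>\<^sub>F x in at_top. \<bar>c x\<bar> < C \<and> norm (r x) < e1 \<and> norm (f x) < e2"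
    by eventually_elim auto
  then obtain X where X: "\<And>x. x \<ge> X \<Longrightarrow> \<bar>c x\<bar> < C \<and> norm (r x) < e1 \<and> norm (f x) < e2"
    by (auto simp: eventually_at_top_linorder)
  have "norm (f' x) < e" if "x \<ge> X" for x
  proof -
    let ?I = "{x..x + d}"
    have "continuous_on ?I (\<lambda>y. norm (f' y))"
      by (intro continuous_on_norm continuous_at_imp_continuous_on ballI has_vector_derivative_continuous [OF f'])
    then obtain z where z: "z \<in> ?I" and zmax: "\<And>y. y \<in> ?I \<Longrightarrow> norm (f' y) \<le> norm (f' z)"
      using continuous_attains_sup [of ?I "\<lambda>y. norm (f' y)"] \<open>d > 0\<close> by fastforce
    define M where "M = norm (f' z)"
    have "M \<ge> 0" by (simp add: M_def)
    define K where "K = C * M + e1"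
    have bnd: "norm (of_real (c y) * f' y + r y) \<le> K" if "y \<in> ?I" for y
    proof -
      have "norm (of_real (c y) * f' y + r y) \<le> \<bar>c y\<bar> * norm (f' y) + norm (r y)"
        by (metis norm_triangle_ineq norm_mult norm_of_real)
      also have "\<dots> \<le> C * M + e1"
        using X [of y] that \<open>x \<ge> X\<close> zmax [OF that] \<open>C > 0\<close>
        by (intro add_mono mult_mono) (auto simp: M_def)
      finally show ?thesis by (simp add: K_def)
    qed
    have osc: "norm (f' y - f' z) \<le> d * K" if "y \<in> ?I" for y
    proof -
      have "norm (f' y - f' z) \<le> K * norm (y - z)"
      proof (rule differentiable_bound [of ?I])
        show "\<And>y. y \<in> ?I \<Longrightarrow> (f' has_derivative (\<lambda>h. h *\<^sub>R (of_real (c y) * f' y + r y))) (at y within ?I)"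
          using f' unfolding has_vector_derivative_def by (blast intro: has_derivative_at_withinI)
        show "onorm (\<lambda>h. h *\<^sub>R (of_real (c y) * f' y + r y)) \<le> K" if "y \<in> ?I" for y
          using mult_right_mono [OF bnd [OF that] abs_ge_zero]
          by (intro onorm_le) (simp add: mult.commute)
      qed (use z that in auto)
      also have "\<dots> \<le> K * d"
        using that z K_def \<open>C > 0\<close> \<open>M \<ge> 0\<close> \<open>e1 > 0\<close> by (intro mult_left_mono) auto
      finally show ?thesis by (simp add: mult.commute)
    qed
    \<comment> \<open>Subtracting the linear function with slope \<open>f' z\<close> leaves the
      derivative \<open>f' y - f' z\<close>, which \<open>osc\<close> bounds by
      \<open>d * K\<close>.\<close>
    have "norm ((f (x + d) - (x + d) *\<^sub>R f' z) - (f x - x *\<^sub>R f' z)) \<le> d * K * norm (x + d - x)"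
    proof (rule differentiable_bound [of ?I "\<lambda>y. f y - y *\<^sub>R f' z" "\<lambda>y h. h *\<^sub>R (f' y - f' z)"])
      show "((\<lambda>y. f y - y *\<^sub>R f' z) has_derivative (\<lambda>h. h *\<^sub>R (f' y - f' z))) (at y within ?I)" for y
      proof -
        have "((\<lambda>y. f y - y *\<^sub>R f' z) has_vector_derivative f' y - f' z) (at y)"
          using has_vector_derivative_diff [OF f has_vector_derivative_scaleR
              [OF DERIV_ident has_vector_derivative_const [of "f' z"]]] by simp
        then show ?thesis
          unfolding has_vector_derivative_def by (rule has_derivative_at_withinI)
      qed
      show "onorm (\<lambda>h. h *\<^sub>R (f' y - f' z)) \<le> d * K" if "y \<in> ?I" for y
        using mult_right_mono [OF osc [OF that] abs_ge_zero]
        by (intro onorm_le) (simp add: mult.commute)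
    qed (use \<open>d > 0\<close> in auto)
    also have "(f (x + d) - (x + d) *\<^sub>R f' z) - (f x - x *\<^sub>R f' z) = (f (x + d) - f x) - d *\<^sub>R f' z"
      by (simp add: algebra_simps)
    finally have 1: "norm ((f (x + d) - f x) - d *\<^sub>R f' z) \<le> d * K * d"
      using \<open>d > 0\<close> by simp
    have "d * M = norm (d *\<^sub>R f' z)" using \<open>d > 0\<close> by (simp add: M_def)
    also have "\<dots> \<le> norm (f (x + d) - f x) + norm ((f (x + d) - f x) - d *\<^sub>R f' z)"
      using norm_triangle_sub [of "d *\<^sub>R f' z" "f (x + d) - f x"] by (simp add: norm_minus_commute)
    also have "\<dots> \<le> (norm (f (x + d)) + norm (f x)) + d * K * d"
      using 1 norm_triangle_ineq4 by (intro add_mono) auto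
    also have "\<dots> \<le> (e2 + e2) + d * K * d"
      using X [of x] X [of "x + d"] \<open>x \<ge> X\<close> \<open>d > 0\<close> by (intro add_mono) auto
    also have "\<dots> = d * (e / 8 + (d * C) * M + d * e1)"
      by (simp add: K_def e2_def algebra_simps)
    also have "\<dots> = d * (e / 4 + M / 2)"
      using \<open>d > 0\<close> unfolding \<open>d * C = 1/2\<close> by (simp add: e1_def)
    finally have "M \<le> e / 4 + M / 2" using \<open>d > 0\<close> by (simp only: mult_le_cancel_left_pos)
    then have "M < e" using \<open>e > 0\<close> by simp
    moreover have "norm (f' x) \<le> M" using zmax [of x] \<open>d > 0\<close> by (simp add: M_def)
    ultimately show ?thesis by simp
  qed
  then show "\<forall>\<^sub>F x in at_top. dist (f' x) 0 < e"
    unfolding eventually_at_top_linorder by auto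
qed

text \<open>Reflection to the other end: the derivative and the coefficient \<open>c\<close> change
  sign, the remainder \<open>r\<close> does not.\<close>

lemma tendsto_0_derivative_at_bot:
  fixes f f' r :: "real \<Rightarrow> complex" and c :: "real \<Rightarrow> real"
  assumes f: "\<And>x. (f has_vector_derivative f' x) (at x)"
    and f': "\<And>x. (f' has_vector_derivative of_real (c x) * f' x + r x) (at x)"
    and c: "(c \<longlongrightarrow> cm) at_bot" and r: "(r \<longlongrightarrow> 0) at_bot" and lim: "(f \<longlongrightarrow> 0) at_bot"
  shows "(f' \<longlongrightarrow> 0) at_bot"
proof -
  have "((\<lambda>x. - f' (- x)) \<longlongrightarrow> 0) at_top"
  proof (rule tendsto_0_derivative_at_top)
    show "((\<lambda>x. f (- x)) has_vector_derivative - f' (- x)) (at x)" for x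
      by (rule has_vector_derivative_mirror [OF f])
    show "((\<lambda>x. - f' (- x)) has_vector_derivative
        of_real (- c (- x)) * - f' (- x) + r (- x)) (at x)" for x
      using has_vector_derivative_minus [OF has_vector_derivative_mirror [OF f', of x]]
      by (simp add: add.commute)
    show "((\<lambda>x. - c (- x)) \<longlongrightarrow> - cm) at_top"
      using c by (intro tendsto_minus) (simp add: filterlim_at_bot_mirror)
  qed (use r lim in \<open>simp_all add: filterlim_at_bot_mirror\<close>)
  from tendsto_minus [OF this] show ?thesis by (simp add: filterlim_at_bot_mirror)
qed

section \<open>Linearization of the MHD operator\<close>

lemma exhaust_5: "(x :: 5) = 1 \<or> x = 2 \<or> x = 3 \<or> x = 4 \<or> x = 5"
proof (induct x)
  case (of_int z)
  then have "0 \<le> z" and "z < 5" by simp_all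
  then have "z = 0 \<or> z = 1 \<or> z = 2 \<or> z = 3 \<or> z = 4" by arith
  then show ?case by auto
qed

lemma forall_5: "(\<forall>i::5. P i) \<longleftrightarrow> P 1 \<and> P 2 \<and> P 3 \<and> P 4 \<and> P 5"
  by (metis exhaust_5)

lemma vector_5 [simp]:
  "(vector [a, b, c, d, e] :: 'a::zero ^ 5) $ 1 = a"
  "(vector [a, b, c, d, e] :: 'a::zero ^ 5) $ 2 = b"
  "(vector [a, b, c, d, e] :: 'a::zero ^ 5) $ 3 = c"
  "(vector [a, b, c, d, e] :: 'a::zero ^ 5) $ 4 = d"
  "(vector [a, b, c, d, e] :: 'a::zero ^ 5) $ 5 = e"
  unfolding vector_def by simp_all

lemma has_vector_derivative_vec:
  fixes f :: "real \<Rightarrow> real ^ 'n"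
  assumes "\<And>i. ((\<lambda>x. f x $ i) has_real_derivative f' $ i) (at x)"
  shows "(f has_vector_derivative f') (at x)"
  unfolding has_vector_derivative_def
proof (subst has_derivative_componentwise_within, intro ballI)
  fix b :: "real ^ 'n" assume "b \<in> Basis"
  then obtain i where b: "b = axis i 1" by (auto simp: Basis_vec_def)
  show "((\<lambda>x. f x \<bullet> b) has_derivative (\<lambda>y. y *\<^sub>R f' \<bullet> b)) (at x)"
    using assms [of i] unfolding b by (simp add: inner_axis has_field_derivative_def mult_commute_abs)
qed

lemma has_variation_divergence:
  assumes "e > 0" "has_variation e (Suc k) f f'" "has_variation e (Suc k) g g'"
  shows "has_variation e k (\<lambda>\<epsilon>. divergence (f \<epsilon>) (g \<epsilon>)) (divergence f' g')"
  using has_variation_add [OF has_variation_d1 [OF assms(1,2)] has_variation_d2 [OF assms(1,3)]]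
  unfolding divergence_def [abs_def] .

lemma has_variation_laplacian:
  assumes "e > 0" "has_variation e (Suc (Suc k)) f f'"
  shows "has_variation e k (\<lambda>\<epsilon>. laplacian (f \<epsilon>)) (laplacian f')"
  using has_variation_add
    [OF has_variation_d1 [OF assms(1) has_variation_d1 [OF assms]]
        has_variation_d2 [OF assms(1) has_variation_d2 [OF assms]]]
  unfolding laplacian_def [abs_def] .

text \<open>Together with \<open>mhd_kappa\<close> this names the local coefficients of
  \<open>mhd_op\<close>, so that one formula for the linearization covers both models.\<close>

definition mhd_beta :: "mhd_model \<Rightarrow> real" where
  "mhd_beta M = (case M of Beta_Model b \<Rightarrow> b | Hybrid_Model \<Rightarrow> 0)"

definition mhd_kappa :: "mhd_model \<Rightarrow> real" where
  "mhd_kappa M = (case M of Beta_Model b \<Rightarrow> 0 | Hybrid_Model \<Rightarrow> 1)"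

text \<open>The rules for variations are applied term by term. The divergence equation is built from
  components 4 and 5, so these are made explicit; for the others, existence is enough to
  differentiate the whole vector.\<close>

lemma mhd_op_has_variation:
  fixes V :: "real \<Rightarrow> real \<Rightarrow> real \<Rightarrow> real ^ 5" and W :: "real \<Rightarrow> real \<Rightarrow> real ^ 5"
  assumes "e > 0" and p: "smooth_fun_on {0<..} p"
    and V: "\<And>j. has_variation e (Suc (Suc 0)) (\<lambda>\<epsilon> y1 y2. V \<epsilon> y1 y2 $ j) (\<lambda>y1 y2. W y1 y2 $ j)"
    and pos: "\<And>\<epsilon> y1 y2. \<bar>\<epsilon>\<bar> < e \<Longrightarrow> V \<epsilon> y1 y2 $ 1 > 0"
  defines "u1 \<equiv> \<lambda>y1 y2. V 0 y1 y2 $ 2 / V 0 y1 y2 $ 1"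
    and "u2 \<equiv> \<lambda>y1 y2. V 0 y1 y2 $ 3 / V 0 y1 y2 $ 1"
    and "u1' \<equiv> \<lambda>y1 y2. W y1 y2 $ 2 / V 0 y1 y2 $ 1 - V 0 y1 y2 $ 2 * W y1 y2 $ 1 / (V 0 y1 y2 $ 1)\<^sup>2"
    and "u2' \<equiv> \<lambda>y1 y2. W y1 y2 $ 3 / V 0 y1 y2 $ 1 - V 0 y1 y2 $ 3 * W y1 y2 $ 1 / (V 0 y1 y2 $ 1)\<^sup>2"
    and "dh \<equiv> divergence (\<lambda>y1 y2. V 0 y1 y2 $ 4) (\<lambda>y1 y2. V 0 y1 y2 $ 5)"
    and "dh' \<equiv> divergence (\<lambda>y1 y2. W y1 y2 $ 4) (\<lambda>y1 y2. W y1 y2 $ 5)"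
  shows "\<exists>D. ((\<lambda>\<epsilon>. mhd_op M \<mu> \<eta> \<nu> p (V \<epsilon>) x1 x2) has_vector_derivative D) (at 0) \<and>
    D $ 4 = - d2 (\<lambda>y1 y2. (u2' y1 y2 * V 0 y1 y2 $ 4 + u2 y1 y2 * W y1 y2 $ 4) -
                          (u1' y1 y2 * V 0 y1 y2 $ 5 + u1 y1 y2 * W y1 y2 $ 5)) x1 x2
      - mhd_beta M * dh' x1 x2 - mhd_kappa M * (u1' x1 x2 * dh x1 x2 + u1 x1 x2 * dh' x1 x2)
      + \<nu> * laplacian (\<lambda>y1 y2. W y1 y2 $ 4) x1 x2 \<and>
    D $ 5 = - d1 (\<lambda>y1 y2. (u1' y1 y2 * V 0 y1 y2 $ 5 + u1 y1 y2 * W y1 y2 $ 5) -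
                          (u2' y1 y2 * V 0 y1 y2 $ 4 + u2 y1 y2 * W y1 y2 $ 4)) x1 x2
      - mhd_kappa M * (u2' x1 x2 * dh x1 x2 + u2 x1 x2 * dh' x1 x2)
      + \<nu> * laplacian (\<lambda>y1 y2. W y1 y2 $ 5) x1 x2"
proof -
  let ?r = "\<lambda>\<epsilon> y1 y2. V \<epsilon> y1 y2 $ 1"
  let ?h1 = "\<lambda>\<epsilon> y1 y2. V \<epsilon> y1 y2 $ 4" and ?h2 = "\<lambda>\<epsilon> y1 y2. V \<epsilon> y1 y2 $ 5"
  let ?v1 = "\<lambda>\<epsilon> y1 y2. V \<epsilon> y1 y2 $ 2 / V \<epsilon> y1 y2 $ 1" and ?v2 = "\<lambda>\<epsilon> y1 y2. V \<epsilon> y1 y2 $ 3 / V \<epsilon> y1 y2 $ 1"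
  note V1 = has_variation_SucD [OF V] and V0 = has_variation_SucD [OF has_variation_SucD [OF V]]
  have nz: "V \<epsilon> y1 y2 $ 1 \<noteq> 0" if "\<bar>\<epsilon>\<bar> < e" for \<epsilon> y1 y2 using pos [OF that, of y1 y2] by simp
  have v1: "has_variation e (Suc (Suc 0)) ?v1 u1'"
    unfolding u1'_def by (rule has_variation_divide [OF \<open>e > 0\<close> V V nz])
  have v2: "has_variation e (Suc (Suc 0)) ?v2 u2'"
    unfolding u2'_def by (rule has_variation_divide [OF \<open>e > 0\<close> V V nz])
  note v1' = has_variation_SucD [OF v1] and v2' = has_variation_SucD [OF v2]
  have pr: "\<exists>f'. has_variation e (Suc 0) (\<lambda>\<epsilon> y1 y2. p (?r \<epsilon> y1 y2)) f'"
    using has_variation_compose [OF \<open>e > 0\<close> V1 pos p] by blast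
  then obtain pr' where pr': "has_variation e (Suc 0) (\<lambda>\<epsilon> y1 y2. p (?r \<epsilon> y1 y2)) pr'" ..
  note rules = has_variation_add has_variation_diff [OF \<open>e > 0\<close>] has_variation_minus [OF \<open>e > 0\<close>]
    has_variation_mult [OF \<open>e > 0\<close>] has_variation_const has_variation_d1 [OF \<open>e > 0\<close>]
    has_variation_d2 [OF \<open>e > 0\<close>] has_variation_divergence [OF \<open>e > 0\<close>]
    has_variation_laplacian [OF \<open>e > 0\<close>]
  note leaves = V V1 V0 v1 v2 v1' v2' pr' has_variation_SucD [OF v1'] has_variation_SucD [OF v2']
  \<comment> \<open>Squares become products and the division by 2 a factor, so that the rules apply
    syntactically; \<open>op\<close> restores the agreement with \<open>mhd_op\<close>.\<close>
  let ?q = "\<lambda>\<epsilon> y1 y2. p (?r \<epsilon> y1 y2) + (?h1 \<epsilon> y1 y2 * ?h1 \<epsilon> y1 y2 + ?h2 \<epsilon> y1 y2 * ?h2 \<epsilon> y1 y2) * (1/2)"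
  let ?c1 = "\<lambda>\<epsilon> y1 y2. - divergence (\<lambda>y1 y2. V \<epsilon> y1 y2 $ 2) (\<lambda>y1 y2. V \<epsilon> y1 y2 $ 3) y1 y2"
  let ?c2 = "\<lambda>\<epsilon> y1 y2. - divergence (\<lambda>y1 y2. ?r \<epsilon> y1 y2 * ?v1 \<epsilon> y1 y2 * ?v1 \<epsilon> y1 y2 - ?h1 \<epsilon> y1 y2 * ?h1 \<epsilon> y1 y2)
                      (\<lambda>y1 y2. ?r \<epsilon> y1 y2 * ?v1 \<epsilon> y1 y2 * ?v2 \<epsilon> y1 y2 - ?h1 \<epsilon> y1 y2 * ?h2 \<epsilon> y1 y2) y1 y2
           - d1 (?q \<epsilon>) y1 y2 - mhd_kappa M * (?h1 \<epsilon> y1 y2 * divergence (?h1 \<epsilon>) (?h2 \<epsilon>) y1 y2)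
           + \<mu> * laplacian (?v1 \<epsilon>) y1 y2 + (\<eta> + \<mu>) * d1 (divergence (?v1 \<epsilon>) (?v2 \<epsilon>)) y1 y2"
  let ?c3 = "\<lambda>\<epsilon> y1 y2. - divergence (\<lambda>y1 y2. ?r \<epsilon> y1 y2 * ?v2 \<epsilon> y1 y2 * ?v1 \<epsilon> y1 y2 - ?h2 \<epsilon> y1 y2 * ?h1 \<epsilon> y1 y2)
                      (\<lambda>y1 y2. ?r \<epsilon> y1 y2 * ?v2 \<epsilon> y1 y2 * ?v2 \<epsilon> y1 y2 - ?h2 \<epsilon> y1 y2 * ?h2 \<epsilon> y1 y2) y1 y2
           - d2 (?q \<epsilon>) y1 y2 - mhd_kappa M * (?h2 \<epsilon> y1 y2 * divergence (?h1 \<epsilon>) (?h2 \<epsilon>) y1 y2)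
           + \<mu> * laplacian (?v2 \<epsilon>) y1 y2 + (\<eta> + \<mu>) * d2 (divergence (?v1 \<epsilon>) (?v2 \<epsilon>)) y1 y2"
  let ?c4 = "\<lambda>\<epsilon> y1 y2. - d2 (\<lambda>y1 y2. ?v2 \<epsilon> y1 y2 * ?h1 \<epsilon> y1 y2 - ?v1 \<epsilon> y1 y2 * ?h2 \<epsilon> y1 y2) y1 y2
           - mhd_beta M * divergence (?h1 \<epsilon>) (?h2 \<epsilon>) y1 y2
           - mhd_kappa M * (?v1 \<epsilon> y1 y2 * divergence (?h1 \<epsilon>) (?h2 \<epsilon>) y1 y2)
           + \<nu> * laplacian (?h1 \<epsilon>) y1 y2"
  let ?c5 = "\<lambda>\<epsilon> y1 y2. - d1 (\<lambda>y1 y2. ?v1 \<epsilon> y1 y2 * ?h2 \<epsilon> y1 y2 - ?v2 \<epsilon> y1 y2 * ?h1 \<epsilon> y1 y2) y1 y2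
           - mhd_kappa M * (?v2 \<epsilon> y1 y2 * divergence (?h1 \<epsilon>) (?h2 \<epsilon>) y1 y2)
           + \<nu> * laplacian (?h2 \<epsilon>) y1 y2"
  \<comment> \<open>The variation stays schematic and is synthesized by the rules.\<close>
  have "\<exists>f'. has_variation e 0 ?c1 f'"
    by (rule exI) (rule leaves rules)+
  then obtain D1 where D1: "has_variation e 0 ?c1 D1" ..
  have "\<exists>f'. has_variation e 0 ?c2 f'"
    by (rule exI) (rule leaves rules)+
  then obtain D2 where D2: "has_variation e 0 ?c2 D2" ..
  have "\<exists>f'. has_variation e 0 ?c3 f'"
    by (rule exI) (rule leaves rules)+
  then obtain D3 where D3: "has_variation e 0 ?c3 D3" ..
  let ?K = "\<lambda>y1 y2. (u2' y1 y2 * V 0 y1 y2 $ 4 + u2 y1 y2 * W y1 y2 $ 4) -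
                          (u1' y1 y2 * V 0 y1 y2 $ 5 + u1 y1 y2 * W y1 y2 $ 5)"
  let ?L = "\<lambda>y1 y2. (u1' y1 y2 * V 0 y1 y2 $ 5 + u1 y1 y2 * W y1 y2 $ 5) -
                          (u2' y1 y2 * V 0 y1 y2 $ 4 + u2 y1 y2 * W y1 y2 $ 4)"
  \<comment> \<open>The summands with factor \<open>0\<close> are the variations of constant
    coefficients, as the product rule produces them.\<close>
  have "has_variation e 0 ?c4 (\<lambda>y1 y2. - d2 ?K y1 y2
      - (0 * dh y1 y2 + mhd_beta M * dh' y1 y2)
      - (0 * (u1 y1 y2 * dh y1 y2) + mhd_kappa M * (u1' y1 y2 * dh y1 y2 + u1 y1 y2 * dh' y1 y2))
      + (0 * laplacian (?h1 0) y1 y2 + \<nu> * laplacian (\<lambda>y1 y2. W y1 y2 $ 4) y1 y2))"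
    unfolding dh_def dh'_def u1_def u2_def by (rule leaves rules)+
  then have D4: "has_variation e 0 ?c4 (\<lambda>y1 y2. - d2 ?K y1 y2
      - mhd_beta M * dh' y1 y2 - mhd_kappa M * (u1' y1 y2 * dh y1 y2 + u1 y1 y2 * dh' y1 y2)
      + \<nu> * laplacian (\<lambda>y1 y2. W y1 y2 $ 4) y1 y2)" (is "has_variation _ _ _ ?D4") by simp
  have "has_variation e 0 ?c5 (\<lambda>y1 y2. - d1 ?L y1 y2
      - (0 * (u2 y1 y2 * dh y1 y2) + mhd_kappa M * (u2' y1 y2 * dh y1 y2 + u2 y1 y2 * dh' y1 y2))
      + (0 * laplacian (?h2 0) y1 y2 + \<nu> * laplacian (\<lambda>y1 y2. W y1 y2 $ 5) y1 y2))"
    unfolding dh_def dh'_def u1_def u2_def by (rule leaves rules)+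
  then have D5: "has_variation e 0 ?c5 (\<lambda>y1 y2. - d1 ?L y1 y2
      - mhd_kappa M * (u2' y1 y2 * dh y1 y2 + u2 y1 y2 * dh' y1 y2)
      + \<nu> * laplacian (\<lambda>y1 y2. W y1 y2 $ 5) y1 y2)" (is "has_variation _ _ _ ?D5") by simp
  have op: "mhd_op M \<mu> \<eta> \<nu> p (V \<epsilon>) x1 x2 =
      vector [?c1 \<epsilon> x1 x2, ?c2 \<epsilon> x1 x2, ?c3 \<epsilon> x1 x2, ?c4 \<epsilon> x1 x2, ?c5 \<epsilon> x1 x2]" for \<epsilon>
    unfolding mhd_op_def Let_def mhd_beta_def mhd_kappa_def by (simp add: power2_eq_square)
  let ?D = "vector [D1 x1 x2, D2 x1 x2, D3 x1 x2, ?D4 x1 x2, ?D5 x1 x2] :: real ^ 5"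
  have comps: "\<forall>i. ((\<lambda>\<epsilon>. mhd_op M \<mu> \<eta> \<nu> p (V \<epsilon>) x1 x2 $ i) has_real_derivative ?D $ i) (at 0)"
    unfolding forall_5 op vector_5
    by (intro conjI has_variation_0 [OF D1] has_variation_0 [OF D2] has_variation_0 [OF D3]
        has_variation_0 [OF D4] has_variation_0 [OF D5])
  have "((\<lambda>\<epsilon>. mhd_op M \<mu> \<eta> \<nu> p (V \<epsilon>) x1 x2) has_vector_derivative ?D) (at 0)"
    by (rule has_vector_derivative_vec) (use comps in blast)
  then show ?thesis by (intro exI [of _ ?D]) simp
qed

lemma has_vector_derivative_nth:
  "(f has_vector_derivative f') F \<Longrightarrow> ((\<lambda>x. f x $ i) has_vector_derivative f' $ i) F"
  by (rule bounded_linear.has_vector_derivative [OF bounded_linear_vec_nth])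

section \<open>Plane-wave perturbations of a planar profile\<close>

lemma wave_has_partials:
  assumes "\<And>x. (f has_vector_derivative f' x) (at x)"
  shows "has_partials (\<lambda>y1 y2. Re (exp (\<i> * of_real (\<xi> * y2)) * f y1))
    (\<lambda>y1 y2. Re (exp (\<i> * of_real (\<xi> * y2)) * f' y1))
    (\<lambda>y1 y2. Re (exp (\<i> * of_real (\<xi> * y2)) * (\<i> * of_real \<xi> * f y1)))"
  unfolding has_partials_def
proof (intro allI conjI)
  fix y1 y2 :: real
  have "((\<lambda>y. exp (\<i> * of_real (\<xi> * y2)) * f y) has_vector_derivative
      exp (\<i> * of_real (\<xi> * y2)) * f' y1) (at y1)"
    by (rule has_vector_derivative_mult_right [OF assms])
  from bounded_linear.has_vector_derivative [OF bounded_linear_Re this]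
  show "((\<lambda>y. Re (exp (\<i> * of_real (\<xi> * y2)) * f y)) has_real_derivative
      Re (exp (\<i> * of_real (\<xi> * y2)) * f' y1)) (at y1)"
    by (simp add: has_real_derivative_iff_has_vector_derivative)
  have "((\<lambda>z. exp (\<i> * (of_real \<xi> * z)) * f y1) has_field_derivative
      exp (\<i> * (of_real \<xi> * of_real y2)) * (\<i> * of_real \<xi> * f y1)) (at (of_real y2))"
    by (auto intro!: derivative_eq_intros)
  from has_vector_derivative_real_field [OF this]
  have "((\<lambda>y. exp (\<i> * of_real (\<xi> * y)) * f y1) has_vector_derivative
      exp (\<i> * of_real (\<xi> * y2)) * (\<i> * of_real \<xi> * f y1)) (at y2)"
    by simp
  from bounded_linear.has_vector_derivative [OF bounded_linear_Re this]
  show "((\<lambda>y. Re (exp (\<i> * of_real (\<xi> * y)) * f y1)) has_real_derivative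
      Re (exp (\<i> * of_real (\<xi> * y2)) * (\<i> * of_real \<xi> * f y1))) (at y2)"
    by (simp add: has_real_derivative_iff_has_vector_derivative)
qed

lemma planar_has_partials:
  assumes "\<And>x. (a has_real_derivative a' x) (at x)"
  shows "has_partials (\<lambda>y1 y2. a y1) (\<lambda>y1 y2. a' y1) (\<lambda>y1 y2. 0)"
  using assms by (simp add: has_partials_def)

text \<open>Order two is what the second-order terms of \<open>mhd_op\<close> use up, and what two
  derivatives of the profile and of the mode provide.\<close>

lemma wave_has_variation:
  assumes a: "\<And>x. (a has_real_derivative a' x) (at x)" "\<And>x. (a' has_real_derivative a'' x) (at x)"
    and f: "\<And>x. (f has_vector_derivative f' x) (at x)" "\<And>x. (f' has_vector_derivative f'' x) (at x)"
  shows "has_variation e (Suc (Suc 0))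
    (\<lambda>\<epsilon> y1 y2. a y1 + \<epsilon> * Re (exp (\<i> * of_real (\<xi> * y2)) * f y1))
    (\<lambda>y1 y2. Re (exp (\<i> * of_real (\<xi> * y2)) * f y1))"
proof (rule has_variation_affine(2) [OF planar_has_partials [OF a(1)] wave_has_partials [OF f(1)]])
  show "has_variation e (Suc 0)
      (\<lambda>\<epsilon> y1 y2. a' y1 + \<epsilon> * Re (exp (\<i> * of_real (\<xi> * y2)) * f' y1))
      (\<lambda>y1 y2. Re (exp (\<i> * of_real (\<xi> * y2)) * f' y1))"
    by (rule has_variation_affine(2) [OF planar_has_partials [OF a(2)] wave_has_partials [OF f(2)]
          has_variation_affine(1) has_variation_affine(1)])
  have if': "((\<lambda>x. \<i> * of_real \<xi> * f x) has_vector_derivative \<i> * of_real \<xi> * f' x) (at x)" for x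
    by (rule has_vector_derivative_mult_right [OF f(1)])
  show "has_variation e (Suc 0)
      (\<lambda>\<epsilon> y1 y2. 0 + \<epsilon> * Re (exp (\<i> * of_real (\<xi> * y2)) * (\<i> * of_real \<xi> * f y1)))
      (\<lambda>y1 y2. Re (exp (\<i> * of_real (\<xi> * y2)) * (\<i> * of_real \<xi> * f y1)))"
    by (rule has_variation_affine(2) [OF planar_has_partials [of "\<lambda>x. 0", OF DERIV_const]
          wave_has_partials [OF if'] has_variation_affine(1) has_variation_affine(1)])
qed

lemma continuous_bounded_if_vanishing:
  fixes q :: "real \<Rightarrow> real"
  assumes c: "continuous_on UNIV q" and "(q \<longlongrightarrow> 0) at_top" "(q \<longlongrightarrow> 0) at_bot"
  obtains B where "B > 0" "\<And>x. \<bar>q x\<bar> \<le> B"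
proof -
  obtain X where X: "\<And>x. x \<ge> X \<Longrightarrow> \<bar>q x\<bar> < 1"
    using tendstoD [OF assms(2), of 1] by (auto simp: eventually_at_top_linorder)
  obtain Y where Y: "\<And>x. x \<le> Y \<Longrightarrow> \<bar>q x\<bar> < 1"
    using tendstoD [OF assms(3), of 1] by (auto simp: eventually_at_bot_linorder)
  have "compact (q ` {Y..X})"
    by (intro compact_continuous_image continuous_on_subset [OF c]) auto
  then obtain B where B: "\<And>x. x \<in> {Y..X} \<Longrightarrow> \<bar>q x\<bar> \<le> B"
    using compact_imp_bounded bounded_iff by (metis image_eqI real_norm_def)
  have "\<bar>q x\<bar> \<le> max B 1" for x
    using X [of x] Y [of x] B [of x] by (cases "x \<ge> X"; cases "x \<le> Y") auto
  then show ?thesis by (intro that [of "max B 1"]) auto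
qed

text \<open>\<open>has_variation\<close> asks for one parameter range on the whole plane. The
  quotient \<open>norm (Z x) / \<rho> x\<close> is bounded by some \<open>B\<close>, because
  \<open>Z\<close> vanishes at both ends while \<open>\<rho>\<close> has positive limits;
  \<open>1 / B\<close> then works, since the exponential has modulus 1.\<close>

lemma perturbed_density_pos:
  fixes \<rho> :: "real \<Rightarrow> real" and Z :: "real \<Rightarrow> complex"
  assumes "continuous_on UNIV \<rho>" "\<And>x. \<rho> x > 0"
    and "(\<rho> \<longlongrightarrow> rp) at_top" "(\<rho> \<longlongrightarrow> rm) at_bot" "rp > 0" "rm > 0"
    and "continuous_on UNIV Z" "(Z \<longlongrightarrow> 0) at_top" "(Z \<longlongrightarrow> 0) at_bot"
  obtains e where "e > 0"
    "\<And>\<epsilon> y1 y2. \<bar>\<epsilon>\<bar> < e \<Longrightarrow> \<rho> y1 + \<epsilon> * Re (exp (\<i> * of_real (\<xi> * y2)) * Z y1) > 0"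
proof -
  let ?q = "\<lambda>x. norm (Z x) / \<rho> x"
  have "continuous_on UNIV ?q"
    using assms(2) by (intro continuous_intros assms) (metis less_irrefl)
  moreover have "(?q \<longlongrightarrow> norm (0::complex) / rp) at_top"
    using assms by (intro tendsto_intros) auto
  moreover have "(?q \<longlongrightarrow> norm (0::complex) / rm) at_bot"
    using assms by (intro tendsto_intros) auto
  ultimately obtain B where B: "B > 0" "\<And>x. \<bar>?q x\<bar> \<le> B"
    using continuous_bounded_if_vanishing [of ?q] by auto
  show ?thesis
  proof (rule that [of "1 / B"])
    fix \<epsilon> y1 y2 assume \<epsilon>: "\<bar>\<epsilon>\<bar> < 1 / B"
    let ?w = "exp (\<i> * of_real (\<xi> * y2)) * Z y1"
    have "norm (Z y1) \<le> B * \<rho> y1"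
      using B(2) [of y1] assms(2) [of y1] by (simp add: pos_divide_le_eq)
    moreover have "norm ?w = norm (Z y1)" by (simp add: norm_mult)
    ultimately have "\<bar>Re ?w\<bar> \<le> B * \<rho> y1" using abs_Re_le_cmod [of ?w] by linarith
    then have "\<bar>\<epsilon>\<bar> * \<bar>Re ?w\<bar> \<le> \<bar>\<epsilon>\<bar> * (B * \<rho> y1)" by (rule mult_left_mono) simp
    also have "\<dots> < 1 / B * (B * \<rho> y1)"
      using \<epsilon> B(1) assms(2) [of y1] by (intro mult_strict_right_mono) auto
    finally have "\<bar>\<epsilon> * Re ?w\<bar> < \<rho> y1" using B(1) by (simp add: abs_mult)
    then show "\<rho> y1 + \<epsilon> * Re ?w > 0" by linarith
  qed (use B in simp)
qed

text \<open>The Fourier coefficient of the linearization of \<open>u\<^sub>2 h\<^sub>1 - u\<^sub>1 h\<^sub>2\<close>.\<close>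

definition emf_hat :: "(real \<Rightarrow> real ^ 5) \<Rightarrow> (real \<Rightarrow> complex ^ 5) \<Rightarrow> real \<Rightarrow> complex" where
  "emf_hat V Z x =
    of_real ((V x $ 5 * V x $ 2 - V x $ 4 * V x $ 3) / (V x $ 1)\<^sup>2) * Z x $ 1
    - of_real (V x $ 5 / V x $ 1) * Z x $ 2 + of_real (V x $ 4 / V x $ 1) * Z x $ 3
    + of_real (V x $ 3 / V x $ 1) * Z x $ 4 - of_real (V x $ 2 / V x $ 1) * Z x $ 5"

lemma emf_hat_smult: "emf_hat V (\<lambda>x. a *s Z x) x = a * emf_hat V Z x"
  by (simp add: emf_hat_def algebra_simps)

lemma tendsto_emf_hat:
  assumes "(V \<longlongrightarrow> Vl) F" "Vl $ 1 > 0" "(Z \<longlongrightarrow> 0) F"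
  shows "(emf_hat V Z \<longlongrightarrow> 0) F"
proof -
  have "(emf_hat V Z \<longlongrightarrow> emf_hat (\<lambda>_. Vl) (\<lambda>_. 0) 0) F"
    unfolding emf_hat_def [abs_def] using assms(2) by (intro tendsto_intros assms) auto
  then show ?thesis by (simp add: emf_hat_def)
qed

text \<open>Existence suffices here, because this derivative cancels in the equation for the
  divergence.\<close>

lemma emf_hat_derivative:
  assumes V: "\<And>j. ((\<lambda>x. V x $ j) has_real_derivative V' j) (at x)" and "V x $ 1 > 0"
    and Z: "(Z has_vector_derivative Z') (at x)"
  obtains K' where "(emf_hat V Z has_vector_derivative K') (at x)"
proof -
  have nz: "V x $ 1 \<noteq> 0" using assms(2) by simp
  have V: "(\<lambda>x. V x $ j) differentiable (at x)" for j
    using V real_differentiable_def by blast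
  have Z: "(\<lambda>x. Z x $ j) differentiable (at x)" for j
    using has_vector_derivative_nth [OF Z] by (rule differentiableI_vector)
  have of_real: "(\<lambda>x. of_real (f x) :: complex) differentiable (at x)"
    if "f differentiable (at x)" for f :: "real \<Rightarrow> real"
    using that bounded_linear.has_derivative [OF bounded_linear_of_real]
    unfolding differentiable_def by blast
  have "emf_hat V Z differentiable (at x)"
    unfolding emf_hat_def [abs_def]
    using nz by (intro differentiable_add differentiable_diff differentiable_mult of_real
        differentiable_divide differentiable_power V Z) auto
  then show ?thesis using that vector_derivative_works by blast
qed

text \<open>At \<open>x2 = 0\<close> the exponential is 1, so Fourier coefficients can be read off.
  The variation of the velocity is multiplied by the divergence of the profile, which vanishes by
  \<open>divV\<close>. The two components of the curl contribute \<open>emf_hat\<close> with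
  opposite signs, once through \<open>d2\<close> and once through \<open>d1\<close>.\<close>

lemma lin_op_real_wave:
  fixes M :: mhd_model and \<mu> \<eta> \<nu> :: real
  assumes sV: "\<And>j. smooth_fun_on UNIV (\<lambda>x. Vbar x $ j)"
    and divV: "\<And>x. deriv (\<lambda>y. Vbar y $ 4) x = 0"
    and p: "smooth_fun_on {0<..} p"
    and e: "e > 0"
      "\<And>\<epsilon> y1 y2. \<bar>\<epsilon>\<bar> < e \<Longrightarrow> Vbar y1 $ 1 + \<epsilon> * Re (exp (\<i> * of_real (\<xi> * y2)) * Z y1 $ 1) > 0"
    and Z: "\<And>x. (Z has_vector_derivative Z' x) (at x)" "\<And>x. (Z' has_vector_derivative Z'' x) (at x)"
    and K: "\<And>x. (emf_hat Vbar Z has_vector_derivative K' x) (at x)"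
  defines "\<phi> \<equiv> \<lambda>x. Z' x $ 4 + \<i> * of_real \<xi> * Z x $ 5"
    and "L \<equiv> \<lambda>x. lin_op_real M \<mu> \<eta> \<nu> p (\<lambda>y1 y2. Vbar y1)
      (\<lambda>y1 y2. \<chi> l. Re (exp (\<i> * of_real (\<xi> * y2)) * Z y1 $ l)) x 0"
  shows "L x $ 4 = Re (- (\<i> * of_real \<xi> * emf_hat Vbar Z x)
      - of_real (mhd_beta M + mhd_kappa M * (Vbar x $ 2 / Vbar x $ 1)) * \<phi> x
      + of_real \<nu> * (Z'' x $ 4 - of_real (\<xi>\<^sup>2) * Z x $ 4))"
    and "L x $ 5 = Re (K' x - of_real (mhd_kappa M * (Vbar x $ 3 / Vbar x $ 1)) * \<phi> x
      + of_real \<nu> * (Z'' x $ 5 - of_real (\<xi>\<^sup>2) * Z x $ 5))"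
proof -
  let ?W = "\<lambda>y1 y2. (\<chi> l. Re (exp (\<i> * of_real (\<xi> * y2)) * Z y1 $ l)) :: real ^ 5"
  let ?V = "\<lambda>\<epsilon> y1 y2. Vbar y1 + \<epsilon> *\<^sub>R ?W y1 y2"
  note dV = smooth_fun_on_DERIV [OF sV open_UNIV UNIV_I]
  note ddV = smooth_fun_on_DERIV [OF smooth_fun_on_deriv [OF sV] open_UNIV UNIV_I]
  note dZ = has_vector_derivative_nth [OF Z(1)] and ddZ = has_vector_derivative_nth [OF Z(2)]
  note wave = wave_has_partials [OF dZ] wave_has_partials [OF ddZ]
    wave_has_partials [OF has_vector_derivative_mult_right [OF dZ]]
  have var: "has_variation e (Suc (Suc 0)) (\<lambda>\<epsilon> y1 y2. ?V \<epsilon> y1 y2 $ j) (\<lambda>y1 y2. ?W y1 y2 $ j)" for j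
    using wave_has_variation [OF dV ddV dZ ddZ, of e j \<xi> j] by simp
  have dh0: "divergence (\<lambda>y1 y2. ?V 0 y1 y2 $ 4) (\<lambda>y1 y2. ?V 0 y1 y2 $ 5) x 0 = 0"
    using divV by (simp add: divergence_def d1_def d2_def)
  have dh': "divergence (\<lambda>y1 y2. ?W y1 y2 $ 4) (\<lambda>y1 y2. ?W y1 y2 $ 5) x 0 = Re (\<phi> x)"
    unfolding divergence_def vec_lambda_beta has_partials_d1 [OF wave(1)] has_partials_d2 [OF wave(1)]
    by (simp add: \<phi>_def)
  have lap: "laplacian (\<lambda>y1 y2. ?W y1 y2 $ j) x 0 = Re (Z'' x $ j - of_real (\<xi>\<^sup>2) * Z x $ j)" for j
    unfolding laplacian_def vec_lambda_beta has_partials_d1 [OF wave(1)] has_partials_d2 [OF wave(1)]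
      has_partials_d1 [OF wave(2)] has_partials_d2 [OF wave(3)]
    by (simp add: power2_eq_square)
  let ?w = "\<lambda>y1 y2. Re (exp (\<i> * of_real (\<xi> * y2)) * emf_hat Vbar Z y1)"
  note Kp = wave_has_partials [OF K]
  obtain D where D: "((\<lambda>\<epsilon>. mhd_op M \<mu> \<eta> \<nu> p (?V \<epsilon>) x 0) has_vector_derivative D) (at 0)"
    and D4: "D $ 4 = - d2 (\<lambda>y1 y2. ((?W y1 y2 $ 3 / Vbar y1 $ 1 - Vbar y1 $ 3 * ?W y1 y2 $ 1 / (Vbar y1 $ 1)\<^sup>2) * Vbar y1 $ 4
            + Vbar y1 $ 3 / Vbar y1 $ 1 * ?W y1 y2 $ 4) -
            ((?W y1 y2 $ 2 / Vbar y1 $ 1 - Vbar y1 $ 2 * ?W y1 y2 $ 1 / (Vbar y1 $ 1)\<^sup>2) * Vbar y1 $ 5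
            + Vbar y1 $ 2 / Vbar y1 $ 1 * ?W y1 y2 $ 5)) x 0
      - mhd_beta M * Re (\<phi> x) - mhd_kappa M * (Vbar x $ 2 / Vbar x $ 1 * Re (\<phi> x))
      + \<nu> * Re (Z'' x $ 4 - of_real (\<xi>\<^sup>2) * Z x $ 4)"
    and D5: "D $ 5 = - d1 (\<lambda>y1 y2. 
            ((?W y1 y2 $ 2 / Vbar y1 $ 1 - Vbar y1 $ 2 * ?W y1 y2 $ 1 / (Vbar y1 $ 1)\<^sup>2) * Vbar y1 $ 5
            + Vbar y1 $ 2 / Vbar y1 $ 1 * ?W y1 y2 $ 5) -
            ((?W y1 y2 $ 3 / Vbar y1 $ 1 - Vbar y1 $ 3 * ?W y1 y2 $ 1 / (Vbar y1 $ 1)\<^sup>2) * Vbar y1 $ 4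
            + Vbar y1 $ 3 / Vbar y1 $ 1 * ?W y1 y2 $ 4)) x 0
      - mhd_kappa M * (Vbar x $ 3 / Vbar x $ 1 * Re (\<phi> x))
      + \<nu> * Re (Z'' x $ 5 - of_real (\<xi>\<^sup>2) * Z x $ 5)"
    using mhd_op_has_variation [OF e(1) p var, where M = M and \<mu> = \<mu> and \<eta> = \<eta> and \<nu> = \<nu> and ?x1.0 = x and ?x2.0 = 0, unfolded dh0 dh' lap]
      e(2) by auto
  have L: "L x = D"
    unfolding L_def lin_op_real_def using D by (rule vector_derivative_at)
  have emf: "(\<lambda>y1 y2. ((?W y1 y2 $ 3 / Vbar y1 $ 1 - Vbar y1 $ 3 * ?W y1 y2 $ 1 / (Vbar y1 $ 1)\<^sup>2) * Vbar y1 $ 4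
            + Vbar y1 $ 3 / Vbar y1 $ 1 * ?W y1 y2 $ 4) -
            ((?W y1 y2 $ 2 / Vbar y1 $ 1 - Vbar y1 $ 2 * ?W y1 y2 $ 1 / (Vbar y1 $ 1)\<^sup>2) * Vbar y1 $ 5
            + Vbar y1 $ 2 / Vbar y1 $ 1 * ?W y1 y2 $ 5)) = ?w"
  proof -
    \<comment> \<open>The reciprocals of the density and of its square become independent reals
      \<open>i\<close> and \<open>s\<close>, which leaves a polynomial identity.\<close>
    have alg: "((Re (E * z3) * i - m2 * Re (E * z1) * s) * h1 + m2 * i * Re (E * z4))
        - ((Re (E * z2) * i - m1 * Re (E * z1) * s) * h2 + m1 * i * Re (E * z5))
      = Re (E * (of_real ((h2 * m1 - h1 * m2) * s) * z1 - of_real (h2 * i) * z2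
          + of_real (h1 * i) * z3 + of_real (m2 * i) * z4 - of_real (m1 * i) * z5))"
      for E z1 z2 z3 z4 z5 :: complex and i s h1 h2 m1 m2 :: real
      by (simp add: algebra_simps)
    show ?thesis
      unfolding emf_hat_def vec_lambda_beta divide_inverse by (intro ext alg)
  qed
  show "L x $ 4 = Re (- (\<i> * of_real \<xi> * emf_hat Vbar Z x)
      - of_real (mhd_beta M + mhd_kappa M * (Vbar x $ 2 / Vbar x $ 1)) * \<phi> x
      + of_real \<nu> * (Z'' x $ 4 - of_real (\<xi>\<^sup>2) * Z x $ 4))"
    unfolding L D4 emf has_partials_d2 [OF Kp] by (simp add: algebra_simps)
  have emf': "(\<lambda>y1 y2. 
            ((?W y1 y2 $ 2 / Vbar y1 $ 1 - Vbar y1 $ 2 * ?W y1 y2 $ 1 / (Vbar y1 $ 1)\<^sup>2) * Vbar y1 $ 5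
            + Vbar y1 $ 2 / Vbar y1 $ 1 * ?W y1 y2 $ 5) -
            ((?W y1 y2 $ 3 / Vbar y1 $ 1 - Vbar y1 $ 3 * ?W y1 y2 $ 1 / (Vbar y1 $ 1)\<^sup>2) * Vbar y1 $ 4
            + Vbar y1 $ 3 / Vbar y1 $ 1 * ?W y1 y2 $ 4)) =
      (\<lambda>y1 y2. Re (exp (\<i> * of_real (\<xi> * y2)) * - emf_hat Vbar Z y1))"
    using emf unfolding fun_eq_iff by (simp only: mult_minus_right uminus_complex.sel) (metis minus_diff_eq)
  show "L x $ 5 = Re (K' x - of_real (mhd_kappa M * (Vbar x $ 3 / Vbar x $ 1)) * \<phi> x
      + of_real \<nu> * (Z'' x $ 5 - of_real (\<xi>\<^sup>2) * Z x $ 5))"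
    unfolding L D5 emf' has_partials_d1 [OF wave_has_partials [OF has_vector_derivative_minus [OF K]]]
    by (simp add: algebra_simps)
qed

section \<open>Normal modes are divergence free\<close>

lemma decaying_normal_mode_imp_transformed_constraint:
  fixes M :: mhd_model and \<mu> \<eta> \<nu> :: real
  assumes "\<nu> > 0" and p: "smooth_fun_on {0<..} p"
    and prof: "viscous_shock_profile M \<mu> \<eta> \<nu> p Vbar Vminus Vplus"
    and mode: "decaying_normal_mode M \<mu> \<eta> \<nu> p Vbar \<xi> lam Vhat"
    and lam: "Re lam \<ge> 0" "(\<xi>, lam) \<noteq> (0, 0)"
  shows "transformed_constraint \<xi> Vhat"
proof -

  \<comment> \<open>Regularity and limits of the profile and the mode\<close>
  have sV: "smooth_fun_on UNIV (\<lambda>x. Vbar x $ j)" for j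
    using prof by (simp add: viscous_shock_profile_def)
  have pV: "Vbar x $ 1 > 0" for x
    using prof by (simp add: viscous_shock_profile_def)
  have ends: "Vminus $ 1 > 0" "Vplus $ 1 > 0" "(Vbar \<longlongrightarrow> Vminus) at_bot" "(Vbar \<longlongrightarrow> Vplus) at_top"
    using prof by (auto simp: viscous_shock_profile_def)
  have divV: "deriv (\<lambda>y. Vbar y $ 4) x = 0" for x
    using prof by (auto simp: viscous_shock_profile_def divergence_def d1_def d2_def)
  note dV = smooth_fun_on_DERIV [OF sV open_UNIV UNIV_I]
  have contV: "continuous_on UNIV (\<lambda>x. Vbar x $ j)" for j
    by (rule DERIV_continuous_on [OF dV])
  obtain Z' Z'' where Z: "\<And>x. (Vhat has_vector_derivative Z' x) (at x)"
    "\<And>x. (Z' has_vector_derivative Z'' x) (at x)"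
    using mode unfolding decaying_normal_mode_def twice_cont_diff_def by blast
  have lim: "(Vhat \<longlongrightarrow> 0) at_bot" "(Vhat \<longlongrightarrow> 0) at_top"
    using mode by (auto simp: decaying_normal_mode_def)
  have lim_nth: "((\<lambda>x. Vhat x $ j) \<longlongrightarrow> 0) at_bot" "((\<lambda>x. Vhat x $ j) \<longlongrightarrow> 0) at_top" for j
    using tendsto_vec_nth [OF lim(1), of j] tendsto_vec_nth [OF lim(2), of j] by simp_all
  note dZ = has_vector_derivative_nth [OF Z(1)] and ddZ = has_vector_derivative_nth [OF Z(2)]
  have contZ: "continuous_on UNIV (\<lambda>x. Vhat x $ j)" for j
    by (intro continuous_at_imp_continuous_on ballI has_vector_derivative_continuous [OF dZ])
  have "\<exists>K'. (emf_hat Vbar Vhat has_vector_derivative K') (at x)" for x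
    by (rule emf_hat_derivative [OF dV pV Z(1)]) blast
  then obtain K' where K: "\<And>x. (emf_hat Vbar Vhat has_vector_derivative K' x) (at x)"
    by metis
  let ?K = "emf_hat Vbar Vhat"
  define b where "b = (\<lambda>x. mhd_beta M + mhd_kappa M * (Vbar x $ 2 / Vbar x $ 1))"
  define a where "a = (\<lambda>x. mhd_kappa M * (Vbar x $ 3 / Vbar x $ 1))"
  define \<phi> where "\<phi> = (\<lambda>x. Z' x $ 4 + \<i> * of_real \<xi> * Vhat x $ 5)"
  define R4 where "R4 = (\<lambda>x. - (\<i> * of_real \<xi> * ?K x) - of_real (b x) * \<phi> x
      + of_real \<nu> * (Z'' x $ 4 - of_real (\<xi>\<^sup>2) * Vhat x $ 4))"
  define R5 where "R5 = (\<lambda>x. K' x - of_real (a x) * \<phi> x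
      + of_real \<nu> * (Z'' x $ 5 - of_real (\<xi>\<^sup>2) * Vhat x $ 5))"

  \<comment> \<open>The mode and its rotation as admissible real perturbations\<close>
  obtain e where e: "e > 0"
    "\<And>\<epsilon> y1 y2. \<bar>\<epsilon>\<bar> < e \<Longrightarrow> Vbar y1 $ 1 + \<epsilon> * Re (exp (\<i> * of_real (\<xi> * y2)) * Vhat y1 $ 1) > 0"
    using perturbed_density_pos [OF contV pV tendsto_vec_nth [OF ends(4)] tendsto_vec_nth [OF ends(3)]
        ends(2,1) contZ lim_nth(2,1)] by metis
  \<comment> \<open>The imaginary part of a number \<open>z\<close> is the real part of
    \<open>- \<i> * z\<close>, so both halves of \<open>lin_op\<close> become instances of
    \<open>lin_op_real_wave\<close>.\<close>
  let ?nZ = "\<lambda>x. - \<i> *s Vhat x"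
  have "continuous_on UNIV (\<lambda>x. ?nZ x $ 1)"
    unfolding vector_smult_component by (intro continuous_intros contZ)
  moreover have "((\<lambda>x. ?nZ x $ 1) \<longlongrightarrow> 0) at_top" "((\<lambda>x. ?nZ x $ 1) \<longlongrightarrow> 0) at_bot"
    unfolding vector_smult_component by (intro tendsto_mult_right_zero lim_nth)+
  ultimately obtain e' where e': "e' > 0"
    "\<And>\<epsilon> y1 y2. \<bar>\<epsilon>\<bar> < e' \<Longrightarrow> Vbar y1 $ 1 + \<epsilon> * Re (exp (\<i> * of_real (\<xi> * y2)) * ?nZ y1 $ 1) > 0"
    using perturbed_density_pos [OF contV pV tendsto_vec_nth [OF ends(4)] tendsto_vec_nth [OF ends(3)]
        ends(2,1), where Z = "\<lambda>x. ?nZ x $ 1" and \<xi> = \<xi>] by metis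
  have bl: "bounded_linear (\<lambda>v :: complex ^ 5. - \<i> *s v)"
    unfolding linear_conv_bounded_linear [symmetric]
    by (rule linearI) (simp_all add: vec_eq_iff distrib_left)
  have nZ: "(?nZ has_vector_derivative - \<i> *s Z' x) (at x)"
    "((\<lambda>x. - \<i> *s Z' x) has_vector_derivative - \<i> *s Z'' x) (at x)" for x
    by (rule bounded_linear.has_vector_derivative [OF bl Z(1)]
        bounded_linear.has_vector_derivative [OF bl Z(2)])+
  have nK: "(emf_hat Vbar ?nZ has_vector_derivative - \<i> * K' x) (at x)" for x
    unfolding emf_hat_smult [abs_def] by (rule has_vector_derivative_mult_right [OF K])

  \<comment> \<open>The two magnetic eigenvalue equations\<close>
  have eqs: "lam * Vhat x $ 4 = R4 x" "lam * Vhat x $ 5 = R5 x" for x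
  proof -
    let ?U = "\<lambda>t x1 x2. exp (lam * of_real t + \<i> * of_real (\<xi> * x2)) *s Vhat x1"
    let ?D = "lin_op M \<mu> \<eta> \<nu> p (\<lambda>y1 y2. Vbar y1) (?U 0) x 0"
    \<comment> \<open>The comparison at \<open>t = 0\<close>, \<open>x2 = 0\<close>, where the
      exponential factor is 1, already yields the eigenvalue equation in \<open>x\<close>.\<close>
    have "((\<lambda>s. ?U s x 0) has_vector_derivative ?D) (at 0)"
      using mode unfolding decaying_normal_mode_def linearized_solution_def by blast
    then have D: "((\<lambda>s. exp (lam * of_real s) * Vhat x $ j) has_vector_derivative ?D $ j) (at 0)" for j
      using has_vector_derivative_nth [of "\<lambda>s. ?U s x 0" ?D "at 0" j] by simp
    have "((\<lambda>z. exp (lam * z) * Vhat x $ j) has_field_derivative lam * Vhat x $ j) (at (of_real 0))" for j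
      by (auto intro!: derivative_eq_intros)
    from has_vector_derivative_real_field [OF this]
    have "((\<lambda>s. exp (lam * of_real s) * Vhat x $ j) has_vector_derivative lam * Vhat x $ j) (at 0)" for j
      by simp
    then have lamD: "lam * Vhat x $ j = ?D $ j" for j
      by (rule vector_derivative_unique_at [OF _ D])
    have Im_Re: "Im (E * z) = Re (E * (- \<i> * z))" for E z :: complex
      by simp
    have D_eq: "?D $ j = Complex
        (lin_op_real M \<mu> \<eta> \<nu> p (\<lambda>y1 y2. Vbar y1)
          (\<lambda>y1 y2. \<chi> l. Re (exp (\<i> * of_real (\<xi> * y2)) * Vhat y1 $ l)) x 0 $ j)
        (lin_op_real M \<mu> \<eta> \<nu> p (\<lambda>y1 y2. Vbar y1)
          (\<lambda>y1 y2. \<chi> l. Re (exp (\<i> * of_real (\<xi> * y2)) * ?nZ y1 $ l)) x 0 $ j)" for j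
      unfolding lin_op_def vec_lambda_beta vector_smult_component Im_Re by simp
    note re = lin_op_real_wave [OF sV divV p e Z K]
    note im = lin_op_real_wave [OF sV divV p e' nZ nK, unfolded emf_hat_smult]
    have re4: "lin_op_real M \<mu> \<eta> \<nu> p (\<lambda>y1 y2. Vbar y1)
          (\<lambda>y1 y2. \<chi> l. Re (exp (\<i> * of_real (\<xi> * y2)) * Vhat y1 $ l)) x 0 $ 4 = Re (R4 x)"
      unfolding R4_def \<phi>_def b_def by (rule re(1))
    have re5: "lin_op_real M \<mu> \<eta> \<nu> p (\<lambda>y1 y2. Vbar y1)
          (\<lambda>y1 y2. \<chi> l. Re (exp (\<i> * of_real (\<xi> * y2)) * Vhat y1 $ l)) x 0 $ 5 = Re (R5 x)"
      unfolding R5_def \<phi>_def a_def by (rule re(2))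
    \<comment> \<open>Complex linearity: multiplying the mode and its derivatives by
      \<open>- \<i>\<close> multiplies \<open>R4\<close> by \<open>- \<i>\<close>.\<close>
    have n4: "- (\<i> * of_real \<xi> * (- \<i> * ?K x)) - of_real (b x) * ((- \<i> *s Z' x) $ 4 + \<i> * of_real \<xi> * (- \<i> *s Vhat x) $ 5)
      + of_real \<nu> * ((- \<i> *s Z'' x) $ 4 - of_real (\<xi>\<^sup>2) * (- \<i> *s Vhat x) $ 4) = - \<i> * R4 x"
      unfolding R4_def \<phi>_def vector_smult_component by (simp only: algebra_simps mult_minus_left mult_minus_right minus_minus)
    have n5: "- \<i> * K' x - of_real (a x) * ((- \<i> *s Z' x) $ 4 + \<i> * of_real \<xi> * (- \<i> *s Vhat x) $ 5)
      + of_real \<nu> * ((- \<i> *s Z'' x) $ 5 - of_real (\<xi>\<^sup>2) * (- \<i> *s Vhat x) $ 5) = - \<i> * R5 x"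
      unfolding R5_def \<phi>_def vector_smult_component by (simp only: algebra_simps mult_minus_left mult_minus_right minus_minus)
    have im4: "lin_op_real M \<mu> \<eta> \<nu> p (\<lambda>y1 y2. Vbar y1)
          (\<lambda>y1 y2. \<chi> l. Re (exp (\<i> * of_real (\<xi> * y2)) * ?nZ y1 $ l)) x 0 $ 4 = Re (- \<i> * R4 x)"
      unfolding n4 [symmetric] b_def by (rule im(1))
    have im5: "lin_op_real M \<mu> \<eta> \<nu> p (\<lambda>y1 y2. Vbar y1)
          (\<lambda>y1 y2. \<chi> l. Re (exp (\<i> * of_real (\<xi> * y2)) * ?nZ y1 $ l)) x 0 $ 5 = Re (- \<i> * R5 x)"
      unfolding n5 [symmetric] a_def by (rule im(2))
    have CR: "Complex (Re z) (Re (- \<i> * z)) = z" for z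
      by (simp add: complex_eq_iff)
    show "lam * Vhat x $ 4 = R4 x" unfolding lamD D_eq re4 im4 by (rule CR)
    show "lam * Vhat x $ 5 = R5 x" unfolding lamD D_eq re5 im5 by (rule CR)
  qed

  \<comment> \<open>The first-order system for the transformed divergence\<close>
  define G where "G = (\<lambda>x. lam * Vhat x $ 4 + \<i> * of_real \<xi> * ?K x
      + of_real \<nu> * of_real (\<xi>\<^sup>2) * Vhat x $ 4 + \<i> * of_real \<xi> * of_real \<nu> * Z' x $ 5)"
  define k where "k = (\<lambda>x. lam + of_real \<nu> * of_real (\<xi>\<^sup>2)
      + \<i> * of_real \<xi> * of_real (a x))"
  have Z4: "of_real \<nu> * Z'' x $ 4 = lam * Vhat x $ 4 + \<i> * of_real \<xi> * ?K x + of_real (b x) * \<phi> x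
      + of_real \<nu> * of_real (\<xi>\<^sup>2) * Vhat x $ 4" for x
    using eqs(1) [of x] unfolding R4_def by (simp add: algebra_simps)
  have Z5: "of_real \<nu> * Z'' x $ 5 = lam * Vhat x $ 5 - K' x
      + of_real (a x) * \<phi> x
      + of_real \<nu> * of_real (\<xi>\<^sup>2) * Vhat x $ 5" for x
    using eqs(2) [of x] unfolding R5_def by (simp add: algebra_simps)
  have nu0: "complex_of_real \<nu> \<noteq> 0" using \<open>\<nu> > 0\<close> by simp
  \<comment> \<open>\<open>G\<close> is \<open>\<nu> \<phi>' - b \<phi>\<close> with the second
    derivative of component 4 eliminated through \<open>Z4\<close>. In this form it contains at most
    first derivatives of the mode, so it can be differentiated once more.\<close>
  have \<phi>': "(\<phi> has_vector_derivative (G x + of_real (b x) * \<phi> x) / of_real \<nu>) (at x)" for x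
  proof -
    have "(\<phi> has_vector_derivative Z'' x $ 4 + \<i> * of_real \<xi> * Z' x $ 5) (at x)"
      unfolding \<phi>_def
      by (intro has_vector_derivative_add has_vector_derivative_mult_right dZ ddZ)
    moreover have "Z'' x $ 4 + \<i> * of_real \<xi> * Z' x $ 5 = (G x + of_real (b x) * \<phi> x) / of_real \<nu>"
    proof -
      have "of_real \<nu> * (Z'' x $ 4 + \<i> * of_real \<xi> * Z' x $ 5) = G x + of_real (b x) * \<phi> x"
        unfolding distrib_left Z4 G_def by (simp add: algebra_simps)
      then show ?thesis using nu0 by (simp only: eq_divide_eq mult.commute) simp
    qed
    ultimately show ?thesis by simp
  qed
  have G': "(G has_vector_derivative k x * \<phi> x) (at x)" for x
  proof -
    have "(G has_vector_derivative lam * Z' x $ 4 + \<i> * of_real \<xi> * K' x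
      + of_real \<nu> * of_real (\<xi>\<^sup>2) * Z' x $ 4 + \<i> * of_real \<xi> * of_real \<nu> * Z'' x $ 5) (at x)"
      unfolding G_def
      by (intro has_vector_derivative_add has_vector_derivative_mult_right dZ ddZ K)
    \<comment> \<open>The terms with \<open>K'\<close> cancel, which expresses that the divergence
      of a curl is zero.\<close>
    moreover have "lam * Z' x $ 4 + \<i> * of_real \<xi> * K' x
      + of_real \<nu> * of_real (\<xi>\<^sup>2) * Z' x $ 4 + \<i> * of_real \<xi> * of_real \<nu> * Z'' x $ 5 = k x * \<phi> x"
      unfolding mult.assoc [of _ "of_real \<nu>"] Z5 unfolding k_def \<phi>_def by (simp add: algebra_simps)
    ultimately show ?thesis by simp
  qed
  have Re_k: "Re (k x) = Re lam + \<nu> * \<xi>\<^sup>2" for x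
    unfolding k_def by simp
  have k0: "Re (k x) \<ge> 0" for x
    unfolding Re_k using lam(1) \<open>\<nu> > 0\<close> by simp
  \<comment> \<open>A zero of \<open>k\<close> forces \<open>\<xi> = 0\<close> through its real
    part, and then \<open>k x = lam\<close>, which is nonzero.\<close>
  have k_nz: "k x \<noteq> 0" for x
  proof
    assume 0: "k x = 0"
    then have "Re lam + \<nu> * \<xi>\<^sup>2 = 0" using Re_k [of x] by simp
    moreover have "\<nu> * \<xi>\<^sup>2 \<ge> 0" using \<open>\<nu> > 0\<close> by simp
    ultimately have "\<nu> * \<xi>\<^sup>2 = 0" using lam(1) by linarith
    then have "\<xi> = 0" using \<open>\<nu> > 0\<close> by simp
    then show False using 0 lam(2) by (simp add: k_def)
  qed
  have b: "continuous_on UNIV b"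
    unfolding b_def using pV by (intro continuous_intros contV) (metis less_irrefl)
  have b_top: "(b \<longlongrightarrow> mhd_beta M + mhd_kappa M * (Vplus $ 2 / Vplus $ 1)) at_top"
    unfolding b_def using ends by (intro tendsto_intros) auto
  have b_bot: "(b \<longlongrightarrow> mhd_beta M + mhd_kappa M * (Vminus $ 2 / Vminus $ 1)) at_bot"
    unfolding b_def using ends by (intro tendsto_intros) auto

  \<comment> \<open>Decay of the divergence at both ends\<close>
  define r where "r = (\<lambda>x. (lam * Vhat x $ 4 + \<i> * of_real \<xi> * ?K x
      + of_real (b x) * (\<i> * of_real \<xi> * Vhat x $ 5)
      + of_real \<nu> * of_real (\<xi>\<^sup>2) * Vhat x $ 4) / of_real \<nu>)"
  \<comment> \<open>Splitting \<open>\<phi>\<close> in the first magnetic equation isolates the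
    derivative of component 4. The remainder \<open>r\<close> involves only undifferentiated
    components of the mode and therefore decays.\<close>
  have Z4': "((\<lambda>x. Z' x $ 4) has_vector_derivative of_real (b x / \<nu>) * Z' x $ 4 + r x) (at x)" for x
  proof -
    have "Z'' x $ 4 = of_real (b x / \<nu>) * Z' x $ 4 + r x"
    proof -
      have "of_real \<nu> * Z'' x $ 4 = of_real \<nu> * (of_real (b x / \<nu>) * Z' x $ 4 + r x)"
      proof -
        have 1: "of_real \<nu> * of_real (b x / \<nu>) = complex_of_real (b x)" using nu0 by simp
        have 2: "of_real \<nu> * r x = lam * Vhat x $ 4 + \<i> * of_real \<xi> * ?K x
            + of_real (b x) * (\<i> * of_real \<xi> * Vhat x $ 5)
            + of_real \<nu> * of_real (\<xi>\<^sup>2) * Vhat x $ 4"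
          unfolding r_def times_divide_eq_right by (rule nonzero_mult_div_cancel_left [OF nu0])
        show ?thesis
          unfolding Z4 \<phi>_def distrib_left [of "of_real \<nu>"] 2 mult.assoc [symmetric] 1
          by (simp add: algebra_simps)
      qed
      then show ?thesis using nu0 unfolding mult_cancel_left by blast
    qed
    then show ?thesis using ddZ [of 4 x] by simp
  qed
  have r0: "(r \<longlongrightarrow> 0) F"
    if "(b \<longlongrightarrow> bl) F" "(?K \<longlongrightarrow> 0) F" "\<And>j. ((\<lambda>x. Vhat x $ j) \<longlongrightarrow> 0) F" for F bl
  proof -
    have "(r \<longlongrightarrow> (lam * 0 + \<i> * of_real \<xi> * 0 + of_real bl * (\<i> * of_real \<xi> * 0)
      + of_real \<nu> * of_real (\<xi>\<^sup>2) * 0) / of_real \<nu>) F"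
      unfolding r_def using nu0 by (intro tendsto_intros that)
    then show ?thesis by simp
  qed
  have b\<nu>: "((\<lambda>x. b x / \<nu>) \<longlongrightarrow> bl / \<nu>) F" if "(b \<longlongrightarrow> bl) F" for F bl
    using \<open>\<nu> > 0\<close> by (intro tendsto_intros that) simp
  have "((\<lambda>x. Z' x $ 4) \<longlongrightarrow> 0) at_top"
    by (rule tendsto_0_derivative_at_top [OF dZ Z4' b\<nu> [OF b_top] r0 [OF b_top _ lim_nth(2)] lim_nth(2)])
      (rule tendsto_emf_hat [OF ends(4,2) lim(2)])
  from tendsto_add [OF this tendsto_mult_right_zero [OF lim_nth(2) [of 5], of "\<i> * of_real \<xi>"]]
  have \<phi>_top: "(\<phi> \<longlongrightarrow> 0) at_top" unfolding \<phi>_def by simp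
  have "((\<lambda>x. Z' x $ 4) \<longlongrightarrow> 0) at_bot"
    by (rule tendsto_0_derivative_at_bot [OF dZ Z4' b\<nu> [OF b_bot] r0 [OF b_bot _ lim_nth(1)] lim_nth(1)])
      (rule tendsto_emf_hat [OF ends(3,1) lim(1)])
  from tendsto_add [OF this tendsto_mult_right_zero [OF lim_nth(1) [of 5], of "\<i> * of_real \<xi>"]]
  have \<phi>_bot: "(\<phi> \<longlongrightarrow> 0) at_bot" unfolding \<phi>_def by simp

  \<comment> \<open>Vanishing of the flux and of the divergence\<close>
  have G0: "G = (\<lambda>x. 0)"
    by (rule ext) (rule flux_eq_0 [OF \<open>\<nu> > 0\<close> \<phi>' G' k0 b b_top b_bot \<phi>_top \<phi>_bot])
  have "k x * \<phi> x = 0" for x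
    by (rule vector_derivative_unique_at [OF G' [of x, unfolded G0] has_vector_derivative_const])
  then have "\<phi> x = 0" for x using k_nz by simp
  then show ?thesis
    unfolding transformed_constraint_def \<phi>_def vector_derivative_at [OF dZ] by (rule allI)
qed

theorem mainTheorem3:
  fixes M :: mhd_model and \<mu> \<eta> \<nu> :: real and p :: "real \<Rightarrow> real"
    and Vbar :: "real \<Rightarrow> real ^ 5" and Vminus Vplus :: "real ^ 5"
  assumes "\<mu> > 0" and "\<eta> > 0" and "\<nu> > 0"
    and "smooth_fun_on {0<..} p"
    and "viscous_shock_profile M \<mu> \<eta> \<nu> p Vbar Vminus Vplus"
    and "weakly_dissipative M \<mu> \<eta> \<nu> p Vminus"
    and "weakly_dissipative M \<mu> \<eta> \<nu> p Vplus"
  shows "(weak_EL_stable_constrained M \<mu> \<eta> \<nu> p Vbar \<longleftrightarrow> weak_EL_stable M \<mu> \<eta> \<nu> p Vbar) \<and>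
         (strong_EL_stable_constrained M \<mu> \<eta> \<nu> p Vbar \<longleftrightarrow> strong_EL_stable M \<mu> \<eta> \<nu> p Vbar)"
proof -
  have strong: "(\<exists>Vhat. decaying_normal_mode M \<mu> \<eta> \<nu> p Vbar \<xi> lam Vhat \<and> transformed_constraint \<xi> Vhat) \<longleftrightarrow>
      (\<exists>Vhat. decaying_normal_mode M \<mu> \<eta> \<nu> p Vbar \<xi> lam Vhat)"
    if "Re lam \<ge> 0 \<and> (\<xi>, lam) \<noteq> (0, 0)" for \<xi> lam
    using decaying_normal_mode_imp_transformed_constraint
      [OF assms(3-5) _ conjunct1 [OF that] conjunct2 [OF that]] by iprover
  \<comment> \<open>\<open>Re lam > 0\<close> excludes \<open>lam = 0\<close>, so the weak range
    lies inside the strong one.\<close>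
  have weak: "(\<exists>Vhat. decaying_normal_mode M \<mu> \<eta> \<nu> p Vbar \<xi> lam Vhat \<and> transformed_constraint \<xi> Vhat) \<longleftrightarrow>
      (\<exists>Vhat. decaying_normal_mode M \<mu> \<eta> \<nu> p Vbar \<xi> lam Vhat)"
    if "Re lam > 0" for \<xi> lam
    by (rule strong) (use that in auto)
  show ?thesis
    unfolding weak_EL_stable_constrained_def weak_EL_stable_def
      strong_EL_stable_constrained_def strong_EL_stable_def
    by (rule conjI; (rule iff_allI)+; rule imp_cong [OF refl]; rule arg_cong [where f = Not])
      (erule weak strong)+
qed

end
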